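(* Let $\mathrm{Th}^3_4:\{-1,1\}^4\to\{0,1\}$ be the function which is $1$ iff at least three input coordinates equal $1$. The distributions $\mathcal D_N^*=(0,0,\frac45,\frac15,0)$ and $\mathcal D_Y^*=(\frac4{15},0,0,\frac{11}{15},0)$ in $\Delta_4$ form a padded one-wise pair $(\mathcal D_Y^*,\mathcal D_N^* )$, via $\tau=\frac15$, $\mathcal D_0=(0,0,0,1,0)$, $\mathcal D'_N=(0,0,1,0,0)$, $\mathcal D'_Y=(\frac13,0,0,\frac23,0)$. Consequently, for every $\epsilon>0$, there is no streaming algorithm using $o(\sqrt n)$ space which $(\frac49+\epsilon)$-approximates $\mathsf{Max\text{-}CSP}(\mathrm{Th}^3_4)$.
   Context: $\Delta_k$ is the set of symmetric probability distributions on $\{-1,1\}^k$ (vectors with the same number of $1$'s are equiprobable); $\mathcal D\in\Delta_k$ is written $(\mathcal D\langle0\rangle,\dots,\mathcal D\langle k\rangle)$, where $\mathcal D\langle i\rangle$ is the total probability of vectors with exactly $i$ coordinates equal to $1$. $\mu(\mathcal D)=\mathbb E_{\mathbf b\sim\mathcal D}[b_1]$. A pair $(\mathcal D_Y,\mathcal D_N)$ of distributions in $\Delta_k$ is a *padded one-wise pair* if there exist $\tau\in[0,1]$ and $\mathcal D_0,\mathcal D'_Y,\mathcal D'_N\in\Delta_k$ such that $\mu(\mathcal D'_Y)=\mu(\mathcal D'_N)=0$, $\mathcal D_Y=\tau\mathcal D_0+(1-\tau)\mathcal D'_Y$ and $\mathcal D_N=\tau\mathcal D_0+(1-\tau)\mathcal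 D'_N$. An $n$-variable instance $\Psi$ of $\mathsf{Max\text{-}CSP}(f)$, $f:\{-1,1\}^k\to\{0,1\}$, is a list of constraints $(\mathbf b(\ell),\mathbf j(\ell))$, $\ell\in[m]$, with non-negative weights $w_\ell$, $W=\sum_\ell w_\ell>0$, where $\mathbf j(\ell)\in[n]^k$ has distinct entries and $\mathbf b(\ell)\in\{-1,1\}^k$. $\mathrm{val}_\Psi=\max_{\boldsymbol\sigma\in\{-1,1\}^n}\frac1W\sum_\ell w_\ell f(b(\ell)_1\sigma_{j(\ell)_1},\dots,b(\ell)_k\sigma_{j(\ell)_k})$. A (randomized, single-pass, insertion-only) streaming algorithm reads the list of constraints once from left to right using limited memory (space). It $a$-approximates $\mathsf{Max\text{-}CSP}(f)$ if on every instance $\Psi$, with probability at least $2/3$, its output $v$ satisfies $a\cdot\mathrm{val}_\Psi\le v\le\mathrm{val}_\Psi$. *)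

theory Defs
  imports "HOL-Probability.Probability" "HOL-Library.Landau_Symbols"
begin

text \<open>Vectors in \<open>{-1,1}^k\<close> are integer lists of length \<open>k\<close>; coordinates are numbered from 0.\<close>

definition cube :: "nat \<Rightarrow> int list set" where
  "cube k = {x. length x = k \<and> set x \<subseteq> {-1, 1}}"

definition ones :: "int list \<Rightarrow> nat" where
  "ones x = card {i. i < length x \<and> x ! i = 1}"

definition Delta :: "nat \<Rightarrow> int list pmf set" where
  "Delta k = {D. set_pmf D \<subseteq> cube k \<and>
     (\<forall>x \<in> cube k. \<forall>y \<in> cube k. ones x = ones y \<longrightarrow> pmf D x = pmf D y)}"

definition layer_mass :: "int list pmf \<Rightarrow> nat \<Rightarrow> real" where
  "layer_mass D i = measure_pmf.prob D {x. ones x = i}"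

definition masses :: "nat \<Rightarrow> int list pmf \<Rightarrow> real list" where
  "masses k D = map (layer_mass D) [0..<Suc k]"

text \<open>The notation \<open>(D\<langle>0\<rangle>, \<dots>, D\<langle>k\<rangle>)\<close> for the element of \<open>Delta k\<close> with these layer masses.
  The description is meaningful only if the entries are nonnegative and sum to 1.\<close>

definition dist_of :: "nat \<Rightarrow> real list \<Rightarrow> int list pmf" where
  "dist_of k p = (THE D. D \<in> Delta k \<and> masses k D = p)"

definition mu :: "int list pmf \<Rightarrow> real" where
  "mu D = measure_pmf.expectation D (\<lambda>b. real_of_int (b ! 0))"

definition is_mixture :: "real \<Rightarrow> 'a pmf \<Rightarrow> 'a pmf \<Rightarrow> 'a pmf \<Rightarrow> bool" where
  "is_mixture \<tau> P Q D \<longleftrightarrow> (\<forall>x. pmf D x = \<tau> * pmf P x + (1 - \<tau>) * pmf Q x)"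

definition padded_one_wise_via ::
  "nat \<Rightarrow> real \<Rightarrow> int list pmf \<Rightarrow> int list pmf \<Rightarrow> int list pmf \<Rightarrow> int list pmf \<Rightarrow> int list pmf \<Rightarrow> bool"
where
  "padded_one_wise_via k \<tau> D0 DY' DN' DY DN \<longleftrightarrow>
     0 \<le> \<tau> \<and> \<tau> \<le> 1 \<and> D0 \<in> Delta k \<and> DY' \<in> Delta k \<and> DN' \<in> Delta k \<and>
     mu DY' = 0 \<and> mu DN' = 0 \<and>
     is_mixture \<tau> D0 DY' DY \<and> is_mixture \<tau> D0 DN' DN"

definition padded_one_wise_pair :: "nat \<Rightarrow> int list pmf \<Rightarrow> int list pmf \<Rightarrow> bool" where
  "padded_one_wise_pair k DY DN \<longleftrightarrow> DY \<in> Delta k \<and> DN \<in> Delta k \<and>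
     (\<exists>\<tau> D0 DY' DN'. padded_one_wise_via k \<tau> D0 DY' DN' DY DN)"

text \<open>A constraint \<open>(b, j, w)\<close> consists of signs, variable indices (from \<open>{0..<n}\<close>) and a weight.\<close>

type_synonym constr = "int list \<times> nat list \<times> real"

definition weight :: "constr \<Rightarrow> real" where
  "weight c = snd (snd c)"

definition total_weight :: "constr list \<Rightarrow> real" where
  "total_weight \<Psi> = sum_list (map weight \<Psi>)"

definition valid_constr :: "nat \<Rightarrow> nat \<Rightarrow> constr \<Rightarrow> bool" where
  "valid_constr k n = (\<lambda>(b, j, w).
     b \<in> cube k \<and> length j = k \<and> distinct j \<and> set j \<subseteq> {..<n} \<and> 0 \<le> w)"

definition csp_instance :: "nat \<Rightarrow> nat \<Rightarrow> constr list \<Rightarrow> bool" where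
  "csp_instance k n \<Psi> \<longleftrightarrow> (\<forall>c \<in> set \<Psi>. valid_constr k n c) \<and> total_weight \<Psi> > 0"

definition constr_value :: "(int list \<Rightarrow> nat) \<Rightarrow> int list \<Rightarrow> constr \<Rightarrow> nat" where
  "constr_value f \<sigma> = (\<lambda>(b, j, w). f (map2 (\<lambda>s i. s * \<sigma> ! i) b j))"

definition assignment_value :: "(int list \<Rightarrow> nat) \<Rightarrow> constr list \<Rightarrow> int list \<Rightarrow> real" where
  "assignment_value f \<Psi> \<sigma> =
     sum_list (map (\<lambda>c. weight c * real (constr_value f \<sigma> c)) \<Psi>) / total_weight \<Psi>"

definition csp_val :: "(int list \<Rightarrow> nat) \<Rightarrow> nat \<Rightarrow> constr list \<Rightarrow> real" where
  "csp_val f n \<Psi> = Max (assignment_value f \<Psi> ` cube n)"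

text \<open>A randomized streaming algorithm knows \<open>n\<close>; its memory contents are bit strings, each
  constraint triggers one (freshly randomized) memory update, and the output is computed from
  the final memory contents. Updates and output are not required to be computable.\<close>

record stream_alg =
  alg_init :: "nat \<Rightarrow> bool list pmf"
  alg_step :: "nat \<Rightarrow> bool list \<Rightarrow> constr \<Rightarrow> bool list pmf"
  alg_out :: "nat \<Rightarrow> bool list \<Rightarrow> real pmf"

definition memory :: "stream_alg \<Rightarrow> nat \<Rightarrow> constr list \<Rightarrow> bool list pmf" where
  "memory A n \<Psi> = foldl (\<lambda>M c. bind_pmf M (\<lambda>s. alg_step A n s c)) (alg_init A n) \<Psi>"

definition alg_output :: "stream_alg \<Rightarrow> nat \<Rightarrow> constr list \<Rightarrow> real pmf" where
  "alg_output A n \<Psi> = bind_pmf (memory A n \<Psi>) (alg_out A n)"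

definition approximates ::
  "stream_alg \<Rightarrow> real \<Rightarrow> nat \<Rightarrow> (int list \<Rightarrow> nat) \<Rightarrow> bool" where
  "approximates A a k f \<longleftrightarrow> (\<forall>n \<Psi>. csp_instance k n \<Psi> \<longrightarrow>
     measure_pmf.prob (alg_output A n \<Psi>) {v. a * csp_val f n \<Psi> \<le> v \<and> v \<le> csp_val f n \<Psi>} \<ge> 2/3)"

definition space_at_most :: "stream_alg \<Rightarrow> nat \<Rightarrow> constr list \<Rightarrow> nat \<Rightarrow> bool" where
  "space_at_most A n \<Psi> s \<longleftrightarrow>
     (\<forall>i \<le> length \<Psi>. \<forall>x \<in> set_pmf (memory A n (take i \<Psi>)). length x \<le> s)"

text \<open>Space is measured, as a function of \<open>n\<close>, on streams of polynomial size: at most \<open>n ^ d\<close>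
  constraints, with integer weights at most \<open>n ^ d\<close>. Bounding it on all streams would be a
  degenerate notion: for fixed \<open>n\<close> a finite memory cannot even estimate the length of the stream,
  so nontrivial approximation would be impossible whatever the bound.
  Correctness (\<open>approximates\<close>) is demanded on all instances.\<close>

definition poly_size :: "nat \<Rightarrow> nat \<Rightarrow> constr list \<Rightarrow> bool" where
  "poly_size d n \<Psi> \<longleftrightarrow> length \<Psi> \<le> n ^ d \<and> (\<forall>c \<in> set \<Psi>. weight c \<in> real ` {..n ^ d})"

definition uses_little_o_space :: "stream_alg \<Rightarrow> nat \<Rightarrow> (nat \<Rightarrow> real) \<Rightarrow> bool" where
  "uses_little_o_space A k g \<longleftrightarrow> (\<forall>d. \<exists>s :: nat \<Rightarrow> nat. (\<lambda>n. real (s n)) \<in> o(g) \<and>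
     (\<forall>n \<Psi>. csp_instance k n \<Psi> \<and> poly_size d n \<Psi> \<longrightarrow> space_at_most A n \<Psi> (s n)))"

definition Th :: "nat \<Rightarrow> int list \<Rightarrow> nat" where
  "Th t x = (if ones x \<ge> t then 1 else 0)"

definition D_N_star :: "int list pmf" where
  "D_N_star = dist_of 4 [0, 0, 4/5, 1/5, 0]"

definition D_Y_star :: "int list pmf" where
  "D_Y_star = dist_of 4 [4/15, 0, 0, 11/15, 0]"

definition D_0 :: "int list pmf" where
  "D_0 = dist_of 4 [0, 0, 0, 1, 0]"

definition D_N_prime :: "int list pmf" where
  "D_N_prime = dist_of 4 [0, 0, 1, 0, 0]"

definition D_Y_prime :: "int list pmf" where
  "D_Y_prime = dist_of 4 [1/3, 0, 0, 2/3, 0]"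

end

theory Submission
  imports Defs "HOL-Real_Asymp.Real_Asymp"
begin

text \<open>Plant a uniformly random hidden assignment. Both kinds of streams begin with constraints on
  random variables whose literal values are distributed as \<open>D_0\<close>; then come four times as many
  distributed as \<open>D_Y_prime\<close> or as \<open>D_N_prime\<close>. The hidden assignment gives streams of the first kind
  value about \<open>11/15\<close>, while by a union bound over all assignments streams of the second kind have
  value at most about \<open>44/135 = 4/9 \<cdot> 11/15\<close>.

  To an algorithm with \<open>s\<close> bits of memory both look like streams whose second part has uniformly
  random signs. Given the memory state, the hidden assignment has density about \<open>2\<^sup>s\<close> on average, so by
  hypercontractivity its Fourier weight at level \<open>k\<close> is \<open>O(s\<^sup>k)\<close>. Since \<open>D_Y_prime\<close> and \<open>D_N_prime\<close> have
  unbiased coordinates, only levels \<open>2, 3, 4\<close> matter, and the next constraint has chi-squared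
  divergence \<open>O((s/n)\<^sup>2)\<close> from noise. These divergences add up to \<open>O(s\<^sup>2/n)\<close> over the \<open>O(n)\<close> constraints,
  which vanishes when \<open>s\<close> is \<open>o(\<surd>n)\<close>. The padding is harmless because it comes first: it only
  influences the memory state from which the second part starts.\<close>

section \<open>Hypercontractivity on the discrete cube\<close>

text \<open>Per constraint the total variation distance from noise is only bounded by order
  \<open>s/n\<close>, and a triangle inequality over linearly many constraints would sum this to
  order \<open>s\<close>, which is useless. The squares of these distances do have a small sum, so
  the hybrid argument has to pay in squares; a potential on acceptance probabilities achieves this.
  The stream length \<open>m\<close> is forced from both sides: a union bound over
  \<open>2^n\<close> assignments with error \<open>\<delta>\<close> needs a large multiple of
  \<open>n/\<delta>^2\<close> constraints, while the loss \<open>m * (s/n)^2\<close> must vanish.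
  With \<open>m\<close> linear in \<open>n\<close> this is the condition that \<open>s\<close> is of
  smaller order than the square root of \<open>n\<close>. One integer \<open>r\<close> bounds the
  logarithm of the number of memory states and is also half the hypercontractive exponent. The count
  \<open>2^r\<close> then enters only through its \<open>r\<close>-th root, the constant 2, and no
  real exponents occur. The value \<open>11/15\<close> is \<open>1/5 + 4/5 * 2/3\<close>, the
  probability that \<open>D_Y_star\<close> satisfies the predicate. The ratio 1:4 of the two blocks
  realises \<open>\<tau> = 1/5\<close> deterministically; sampling every constraint from the mixture
  would not let the padding come first.\<close>

lemma choose_Suc_mult:
  assumes "i \<le> m"
  shows "real (m choose Suc i) * real (Suc i) = real (m choose i) * (real m - real i)"
proof (cases m)
  case 0
  then show ?thesis using assms by simp
next
  case (Suc m')
  have "Suc i * (m choose Suc i) = (m - i) * (m choose i)"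
    using Suc_times_binomial[of i m'] binomial_absorb_comp[of m i] Suc by simp
  then have "real (Suc i) * real (m choose Suc i) = real (m - i) * real (m choose i)"
    by (metis of_nat_mult)
  with assms show ?thesis by (simp add: of_nat_diff mult.commute)
qed

text \<open>Going from \<open>j\<close> to \<open>j + 1\<close> multiplies the two binomials by
  factors whose quotient is \<open>(2r - 2j - 1)/(2j + 1)\<close>, which is at most
  \<open>2r - 1\<close>. This is the coefficient comparison behind \<open>two_point\<close>.\<close>

lemma choose_double_le:
  assumes "j \<le> r"
  shows "real ((2*r) choose (2*j)) \<le> (2 * real r - 1)^j * real (r choose j)"
  using assms
proof (induction j)
  case 0
  then show ?case by simp
next
  case (Suc j)
  then have jr: "j < r" by simp
  have 1: "real ((2*r) choose (2*Suc j)) * real (2*j+1) * real (Suc j)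
      = real ((2*r) choose (2*j)) * (real r - real j) * (2 * real r - 2 * real j - 1)"
  proof -
    have "real ((2*r) choose (2*Suc j)) * (2 * real (Suc j)) =
        real ((2*r) choose (2*j+1)) * (2 * real r - 2 * real j - 1)"
      using choose_Suc_mult[of "2*j+1" "2*r"] jr by (simp add: algebra_simps)
    then have "real ((2*r) choose (2*Suc j)) * (2 * real (Suc j)) * real (2*j+1) =
        (real ((2*r) choose (2*j+1)) * real (2*j+1)) * (2 * real r - 2 * real j - 1)"
      by simp
    also have "real ((2*r) choose (2*j+1)) * real (2*j+1) = real ((2*r) choose (2*j)) * (2 * real r - 2 * real j)"
      using choose_Suc_mult[of "2*j" "2*r"] jr by simp
    finally show ?thesis by (simp add: algebra_simps)
  qed
  have 2: "real (r choose Suc j) * real (Suc j) = real (r choose j) * (real r - real j)"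
    using choose_Suc_mult[of j r] jr by simp
  have "real ((2*r) choose (2*Suc j)) * real (Suc j) \<le> real ((2*r) choose (2*Suc j)) * real (2*j+1) * real (Suc j)"
    by (simp add: mult_left_mono mult_right_mono algebra_simps)
  also have "\<dots> \<le> ((2 * real r - 1)^j * real (r choose j)) * (real r - real j) * (2 * real r - 1)"
    unfolding 1 using jr Suc.IH by (intro mult_mono) auto
  also have "\<dots> = (2 * real r - 1)^(Suc j) * (real (r choose j) * (real r - real j))"
    by (simp only: power_Suc mult_ac)
  also have "\<dots> = (2 * real r - 1)^(Suc j) * real (r choose Suc j) * real (Suc j)"
    by (simp only: 2[symmetric] mult.assoc)
  finally show ?case by (simp del: of_nat_Suc)
qed

lemma even_power_sum:
  fixes u v :: real
  shows "(u + v)^(2*r) + (u - v)^(2*r) = 2 * (\<Sum>j\<le>r. real ((2*r) choose (2*j)) * v^(2*j) * u^(2*(r-j)))"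
proof -
  let ?t = "\<lambda>k. real ((2*r) choose k) * v^k * u^(2*r-k)"
  have "(u + v)^(2*r) + (u - v)^(2*r) = (\<Sum>k\<le>2*r. (1 + (-1)^k) * ?t k)"
    using binomial_ring[of v u "2*r"] binomial_ring[of "-v" u "2*r"]
    by (simp add: sum.distrib[symmetric] algebra_simps power_minus[of v])
  also have "\<dots> = (\<Sum>k\<in>(\<lambda>j. 2*j) ` {..r}. (1 + (-1)^k) * ?t k)"
  proof (rule sum.mono_neutral_right)
    show "\<forall>i\<in>{..2 * r} - (*) 2 ` {..r}. (1 + (- 1) ^ i) * ?t i = 0"
    proof
      fix i assume i: "i \<in> {..2*r} - (*) 2 ` {..r}"
      have "odd i"
      proof
        assume "even i"
        then obtain j where "i = 2*j" by blast
        with i show False by auto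
      qed
      then show "(1 + (- 1) ^ i) * ?t i = 0" by simp
    qed
  qed auto
  also have "\<dots> = (\<Sum>j\<le>r. 2 * ?t (2*j))"
    by (subst sum.reindex) (auto simp: inj_on_def)
  finally show ?thesis by (simp add: sum_distrib_left right_diff_distrib')
qed

text \<open>The one-bit case of Bonami's inequality from \<open>L^2\<close> to
  \<open>L^(2r)\<close>, with roots cleared. Odd powers of \<open>h\<close> cancel, and the noise
  rate \<open>\<rho> = 1/sqrt(2r - 1)\<close> is the one for which \<open>choose_double_le\<close>
  compares the remaining binomial terms one by one.\<close>

lemma two_point:
  fixes g h \<rho> :: real
  assumes "(2 * real r - 1) * \<rho>\<^sup>2 = 1" "r \<ge> 1"
  shows "(g + \<rho> * h)^(2*r) + (g - \<rho> * h)^(2*r) \<le> 2 * (g\<^sup>2 + h\<^sup>2)^r"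
proof -
  have "(\<Sum>j\<le>r. real ((2*r) choose (2*j)) * (\<rho>*h)^(2*j) * g^(2*(r-j)))
     \<le> (\<Sum>j\<le>r. real (r choose j) * (h\<^sup>2)^j * (g\<^sup>2)^(r-j))"
  proof (rule sum_mono)
    fix j assume j: "j \<in> {..r}"
    have "real ((2*r) choose (2*j)) * \<rho>^(2*j) \<le> ((2 * real r - 1)^j * real (r choose j)) * \<rho>^(2*j)"
      using j by (intro mult_right_mono choose_double_le) auto
    also have "\<dots> = real (r choose j) * ((2 * real r - 1) * \<rho>\<^sup>2)^j"
      by (simp add: power_mult_distrib power_mult)
    finally have 1: "real ((2*r) choose (2*j)) * \<rho>^(2*j) \<le> real (r choose j)"
      using assms by simp
    have "real ((2*r) choose (2*j)) * \<rho>^(2*j) * (h^(2*j) * g^(2*(r-j))) \<le> real (r choose j) * (h^(2*j) * g^(2*(r-j)))"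
      by (rule mult_right_mono[OF 1]) auto
    then show "real ((2*r) choose (2*j)) * (\<rho>*h)^(2*j) * g^(2*(r-j)) \<le> real (r choose j) * (h\<^sup>2)^j * (g\<^sup>2)^(r-j)"
      by (simp add: power_mult_distrib power_mult[symmetric] mult_ac)
  qed
  then show ?thesis
    using even_power_sum[of g "\<rho>*h" r] binomial_ring[of "h\<^sup>2" "g\<^sup>2" r] by (simp add: add.commute)
qed


lemma convex_power_nonneg: "convex_on {0..} (\<lambda>x::real. x^r)"
  using convex_power_odd[of r] convex_on_subset[OF convex_power_even[of r]] by (cases "even r") auto

text \<open>Minkowski's inequality in \<open>L\<^sup>r\<close>, with the roots cleared.\<close>

lemma sum_add_power_le:
  fixes u v w :: "'a \<Rightarrow> real"
  assumes "finite A" and nn: "\<And>x. x \<in> A \<Longrightarrow> 0 \<le> u x" "\<And>x. x \<in> A \<Longrightarrow> 0 \<le> v x"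
    and w: "\<And>x. x \<in> A \<Longrightarrow> 0 < w x" and "0 \<le> a" "0 \<le> b" "1 \<le> r"
    and ua: "(\<Sum>x\<in>A. w x * u x^r) \<le> a^r" and vb: "(\<Sum>x\<in>A. w x * v x^r) \<le> b^r"
  shows "(\<Sum>x\<in>A. w x * (u x + v x)^r) \<le> (a + b)^r"
proof -
  have zero: "\<forall>x\<in>A. y x = 0" if "\<And>x. x \<in> A \<Longrightarrow> 0 \<le> y x" "(\<Sum>x\<in>A. w x * y x^r) \<le> 0^r" for y :: "'a \<Rightarrow> real"
  proof -
    have "(\<Sum>x\<in>A. w x * y x^r) \<le> 0" using that(2) \<open>1 \<le> r\<close> by (simp add: zero_power)
    moreover have "\<And>x. x \<in> A \<Longrightarrow> 0 \<le> w x * y x^r" using that(1) w by (simp add: less_imp_le)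
    ultimately have "\<forall>x\<in>A. w x * y x^r = 0"
      by (metis (no_types, lifting) \<open>finite A\<close> order_antisym sum_nonneg sum_nonneg_eq_0_iff)
    then show ?thesis using w by fastforce
  qed
  consider "a = 0" | "b = 0" | "a > 0" "b > 0" using assms(5,6) by linarith
  then show ?thesis
  proof cases
    case 1
    then show ?thesis using zero[of u] ua vb nn by simp
  next
    case 2
    then show ?thesis using zero[of v] ua vb nn by simp
  next
    case 3
    define s where "s = a + b"
    have s: "s > 0" using 3 s_def by simp
    \<comment> \<open>\<open>(u x + v x)/s\<close> is the convex combination of \<open>u x/a\<close>
      and \<open>v x/b\<close> with weights \<open>a/s\<close> and \<open>b/s\<close>. The divisions
      are the reason for treating \<open>a = 0\<close> and \<open>b = 0\<close> apart.\<close>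
    have pt: "(u x + v x)^r \<le> s^r * (a/s * (u x/a)^r + b/s * (v x/b)^r)" if "x \<in> A" for x
    proof -
      have "(a/s * (u x/a) + b/s * (v x/b))^r \<le> a/s * (u x/a)^r + b/s * (v x/b)^r"
        using convex_onD[OF convex_power_nonneg, of "b/s" "u x/a" "v x/b" r] 3 nn[OF that] s
        by (simp add: s_def field_simps)
      then have "s^r * (a/s * (u x/a) + b/s * (v x/b))^r \<le> s^r * (a/s * (u x/a)^r + b/s * (v x/b)^r)"
        using s by (intro mult_left_mono) auto
      moreover have "s^r * (a/s * (u x/a) + b/s * (v x/b))^r = (u x + v x)^r"
        using 3 s by (simp flip: power_mult_distrib add: field_simps)
      ultimately show ?thesis by simp
    qed
    have "(\<Sum>x\<in>A. w x * (u x + v x)^r) \<le> (\<Sum>x\<in>A. w x * (s^r * (a/s * (u x/a)^r + b/s * (v x/b)^r)))"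
      using pt w by (intro sum_mono mult_left_mono) (auto intro: less_imp_le)
    also have "\<dots> = s^r * (a/s * ((\<Sum>x\<in>A. w x * u x^r) / a^r) + b/s * ((\<Sum>x\<in>A. w x * v x^r)/ b^r))"
      by (simp add: sum_distrib_left sum.distrib sum_divide_distrib power_divide algebra_simps)
    also have "\<dots> \<le> s^r * (a/s * 1 + b/s * 1)"
      using s 3 ua vb by (intro mult_left_mono add_mono) (auto simp: divide_le_eq)
    also have "\<dots> = s^r" using s by (simp add: s_def add_divide_distrib[symmetric])
    finally show ?thesis by (simp add: s_def)
  qed
qed

text \<open>The set \<open>X\<close> encodes a point of the cube by its coordinates equal to -1, so
  this is the character \<open>(-1)^card (S \<inter> X)\<close> for finite \<open>S\<close>.\<close>

definition walsh :: "'a set \<Rightarrow> 'a set \<Rightarrow> real" where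
  "walsh S X = (\<Prod>i\<in>S. if i \<in> X then -1 else 1)"

lemma walsh_insert:
  assumes "finite A" "a \<notin> A" "S \<in> Pow A" "X \<in> Pow A"
  shows "walsh S (insert a X) = walsh S X" "walsh (insert a S) X = walsh S X"
    "walsh (insert a S) (insert a X) = - walsh S X"
proof -
  have *: "finite S" "a \<notin> S" "a \<notin> X" using assms finite_subset by auto
  show 1: "walsh S (insert a X) = walsh S X"
    unfolding walsh_def using * by (intro prod.cong) auto
  show "walsh (insert a S) X = walsh S X" using * by (simp add: walsh_def)
  show "walsh (insert a S) (insert a X) = - walsh S X"
    using * 1 by (simp add: walsh_def)
qed

lemma sum_Pow_insert:
  fixes f :: "'a set \<Rightarrow> real"
  assumes "finite A" "a \<notin> A"
  shows "sum f (Pow (insert a A)) = (\<Sum>X\<in>Pow A. f X + f (insert a X))"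
proof -
  have "inj_on (insert a) (Pow A)" using assms by (auto simp: inj_on_def insert_ident)
  moreover have "Pow A \<inter> insert a ` Pow A = {}" using assms by auto
  ultimately show ?thesis
    using assms by (simp add: Pow_insert sum.union_disjoint sum.reindex sum.distrib)
qed

text \<open>Induction on the coordinates: splitting off \<open>a\<close> turns the noisy polynomial
  into \<open>g X \<plusminus> \<rho> * h X\<close>. The two-point inequality handles the bit
  \<open>a\<close>, and Minkowski's inequality for the squares of \<open>g\<close> and
  \<open>h\<close> lets the induction hypothesis be applied to the two halves of the
  coefficients.\<close>

lemma hypercontractive:
  fixes c :: "'a set \<Rightarrow> real"
  assumes "finite A" and \<rho>: "(2 * real r - 1) * \<rho>\<^sup>2 = 1" and r: "r \<ge> 1"
  shows "(\<Sum>X\<in>Pow A. (1/2^card A) * (\<Sum>S\<in>Pow A. \<rho>^card S * c S * walsh S X)^(2*r)) \<le> (\<Sum>S\<in>Pow A. (c S)\<^sup>2)^r"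
  using assms(1)
proof (induction A arbitrary: c rule: finite_induct)
  case empty
  then show ?case by (simp add: walsh_def power_mult)
next
  case (insert a A)
  define g where "g X = (\<Sum>S\<in>Pow A. \<rho>^card S * c S * walsh S X)" for X
  define h where "h X = (\<Sum>S\<in>Pow A. \<rho>^card S * c (insert a S) * walsh S X)" for X
  have card: "card (insert a S) = Suc (card S)" if "S \<in> Pow A" for S
    using that insert finite_subset by (metis PowD card_insert_disjoint subsetD)
  have 1: "(\<Sum>S\<in>Pow (insert a A). \<rho>^card S * c S * walsh S X) = g X + \<rho> * h X" if "X \<in> Pow A" for X
    unfolding sum_Pow_insert[OF insert(1,2)] g_def h_def sum_distrib_left sum.distrib[symmetric]
    using walsh_insert[OF insert(1,2) _ that] card by (intro sum.cong) auto
  have 2: "(\<Sum>S\<in>Pow (insert a A). \<rho>^card S * c S * walsh S (insert a X)) = g X - \<rho> * h X" if "X \<in> Pow A" for X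
    unfolding sum_Pow_insert[OF insert(1,2)] g_def h_def sum_distrib_left sum_subtractf[symmetric]
    using walsh_insert[OF insert(1,2) _ that] card by (intro sum.cong) auto
  have "(\<Sum>X\<in>Pow (insert a A). (1/2^card (insert a A)) * (\<Sum>S\<in>Pow (insert a A). \<rho>^card S * c S * walsh S X)^(2*r))
     = (\<Sum>X\<in>Pow A. (1/2^card (insert a A)) * ((g X + \<rho> * h X)^(2*r) + (g X - \<rho> * h X)^(2*r)))"
    unfolding sum_Pow_insert[OF insert(1,2), of "\<lambda>X. (1/2^card (insert a A)) * (\<Sum>S\<in>Pow (insert a A). \<rho>^card S * c S * walsh S X)^(2*r)"]
    using 1 2 by (intro sum.cong) (auto simp: ring_distribs simp del: times_divide_eq_left)
  also have "\<dots> \<le> (\<Sum>X\<in>Pow A. (1/2^card (insert a A)) * (2 * ((g X)\<^sup>2 + (h X)\<^sup>2)^r))"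
    using two_point[OF \<rho> r] by (intro sum_mono mult_left_mono) auto
  also have "\<dots> = (\<Sum>X\<in>Pow A. (1/2^card A) * ((g X)\<^sup>2 + (h X)\<^sup>2)^r)"
    using insert by (intro sum.cong) auto
  also have "\<dots> \<le> ((\<Sum>S\<in>Pow A. (c S)\<^sup>2) + (\<Sum>S\<in>Pow A. (c (insert a S))\<^sup>2))^r"
    using insert.IH[of c] insert.IH[of "\<lambda>S. c (insert a S)"] insert(1) r
    by (intro sum_add_power_le) (auto simp: g_def h_def sum_nonneg power_mult)
  also have "\<dots> = (\<Sum>S\<in>Pow (insert a A). (c S)\<^sup>2)^r"
    unfolding sum_Pow_insert[OF insert(1,2)] by (simp add: sum.distrib)
  finally show ?case .
qed

text \<open>On a form of degree \<open>k\<close> the noise operator is multiplication by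
  \<open>\<rho>^k\<close>, so it can be undone by scaling the coefficients; squaring the scale
  produces the factor \<open>(2r - 1)^k\<close>.\<close>

lemma homogeneous_hypercontractive:
  fixes c :: "'a set \<Rightarrow> real"
  assumes "finite A" and r: "r \<ge> 1" and c: "\<And>S. card S \<noteq> k \<Longrightarrow> c S = 0"
  shows "(\<Sum>X\<in>Pow A. (1/2^card A) * (\<Sum>S\<in>Pow A. c S * walsh S X)^(2*r))
    \<le> ((2 * real r - 1)^k * (\<Sum>S\<in>Pow A. (c S)\<^sup>2))^r"
proof -
  define R where "R = 2 * real r - 1"
  have R: "R \<ge> 1" using r by (simp add: R_def)
  define \<rho> where "\<rho> = 1 / sqrt R"
  have \<rho>: "(2 * real r - 1) * \<rho>\<^sup>2 = 1" using R unfolding R_def[symmetric] \<rho>_def by (simp add: power_divide)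
  have "(\<Sum>X\<in>Pow A. (1/2^card A) * (\<Sum>S\<in>Pow A. c S * walsh S X)^(2*r))
     = (\<Sum>X\<in>Pow A. (1/2^card A) * (\<Sum>S\<in>Pow A. \<rho>^card S * (sqrt R^k * c S) * walsh S X)^(2*r))"
  proof -
    have "c S = \<rho>^card S * (sqrt R^k * c S)" for S
    proof (cases "card S = k")
      case True
      then show ?thesis using R by (simp add: \<rho>_def power_divide)
    next
      case False
      then show ?thesis using c by simp
    qed
    then have "(\<Sum>S\<in>Pow A. c S * walsh S X) = (\<Sum>S\<in>Pow A. \<rho>^card S * (sqrt R^k * c S) * walsh S X)" for X
      by (intro sum.cong arg_cong2[where f="(*)"] refl) 
    then show ?thesis by (simp only:)
  qed
  also have "\<dots> \<le> (\<Sum>S\<in>Pow A. (sqrt R^k * c S)\<^sup>2)^r"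
    by (rule hypercontractive[OF assms(1) \<rho> r])
  also have "(\<Sum>S\<in>Pow A. (sqrt R^k * c S)\<^sup>2) = R^k * (\<Sum>S\<in>Pow A. (c S)\<^sup>2)"
    using R by (simp add: power_mult_distrib sum_distrib_left power_mult[symmetric] mult.commute[of k 2])
      (simp add: power_mult)
  finally show ?thesis by (simp add: R_def)
qed

section \<open>Level inequalities\<close>

text \<open>Testing \<open>f\<close> against its own degree-\<open>k\<close> part; the mass \<open>a\<close> is kept so that the bound can be
  averaged over the memory states.\<close>

lemma level_inequality:
  fixes f :: "'a set \<Rightarrow> real"
  assumes "finite A" and r: "r \<ge> 1"
    and f: "\<And>X. X \<in> Pow A \<Longrightarrow> 0 \<le> f X" "\<And>X. X \<in> Pow A \<Longrightarrow> f X \<le> 1/2^card A"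
    and a: "a = (\<Sum>X\<in>Pow A. f X)" "a > 0"
    and F: "\<And>S. F S = (\<Sum>X\<in>Pow A. f X * walsh S X)"
    and W: "W = (\<Sum>S | S \<subseteq> A \<and> card S = k. (F S)\<^sup>2)"
  shows "a * (W / (a\<^sup>2 * (2 * real r - 1)^k))^r \<le> 1"
proof -
  define R where "R = 2 * real r - 1"
  have R: "R \<ge> 1" using r by (simp add: R_def)
  define c where "c S = (if card S = k then F S else 0)" for S
  define g where "g X = (\<Sum>S\<in>Pow A. c S * walsh S X)" for X
  have fin: "finite (Pow A)" using \<open>finite A\<close> by simp
  have W1: "W = (\<Sum>S\<in>Pow A. (c S)\<^sup>2)" unfolding W c_def using fin
    by (intro sum.mono_neutral_cong_left) auto
  then have W0: "W \<ge> 0" by (simp add: sum_nonneg)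
  have "W = (\<Sum>S\<in>Pow A. c S * F S)" unfolding W1 c_def by (intro sum.cong) (auto simp: power2_eq_square)
  also have "\<dots> = (\<Sum>X\<in>Pow A. f X * g X)"
    unfolding F g_def sum_distrib_left by (subst sum.swap) (simp add: mult_ac)
  finally have W2: "W = (\<Sum>X\<in>Pow A. f X * g X)" .
  have "(W/a)^(2*r) = (\<Sum>X\<in>Pow A. (f X / a) *\<^sub>R g X)^(2*r)"
    by (simp add: W2 sum_divide_distrib)
  \<comment> \<open>Jensen's inequality for the probability weights \<open>f X / a\<close>. The
    pointwise bound on \<open>f\<close> then replaces them by the uniform measure at the price of a
    factor \<open>1/a\<close>.\<close>
  also have "\<dots> \<le> (\<Sum>X\<in>Pow A. (f X / a) * (g X)^(2*r))"
    using f a fin by (intro convex_on_sum[OF _ _ convex_power_even]) (auto simp flip: sum_divide_distrib)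
  also have "\<dots> \<le> (\<Sum>X\<in>Pow A. (1/2^card A / a) * (g X)^(2*r))"
    using f a by (intro sum_mono mult_right_mono divide_right_mono) (auto simp: power_mult)
  also have "\<dots> = (1/a) * (\<Sum>X\<in>Pow A. (1/2^card A) * (g X)^(2*r))"
    by (simp add: sum_distrib_left mult.commute)
  also have "\<dots> \<le> (1/a) * (R^k * W)^r"
    unfolding g_def W1 R_def using a
    by (intro mult_left_mono homogeneous_hypercontractive[OF \<open>finite A\<close> r]) (auto simp: c_def)
  finally have *: "(W/a)^(2*r) \<le> (1/a) * (R^k * W)^r" .
  show ?thesis
  proof (cases "W = 0")
    case True
    then show ?thesis using r by (simp add: zero_power)
  next
    case False
    then have Wp: "W > 0" using W0 by simp
    have "a * (W / (a\<^sup>2 * R^k))^r = a * (W/a)^(2*r) / (R^k * W)^r"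
      using Wp a R by (simp add: power_mult power_divide power_mult_distrib power2_eq_square)
    also have "\<dots> \<le> 1"
      using * Wp a R by (simp add: field_simps)
    finally show ?thesis by (simp add: R_def)
  qed
qed

text \<open>Here \<open>p X s\<close> is the joint probability of hidden assignment and memory
  state. Every state satisfies \<open>a s * V s^r \<le> 1\<close>, so at most \<open>2^r\<close>
  states contribute at most \<open>2^r\<close>, and Jensen's inequality for the \<open>r\<close>-th
  power bounds the mean of \<open>V\<close> by 2.\<close>

lemma level_inequality_average:
  fixes p :: "'a set \<Rightarrow> 's \<Rightarrow> real"
  assumes "finite A" "finite \<Sigma>" "card \<Sigma> \<le> 2^r" and r: "r \<ge> 1"
    and p: "\<And>X s. X \<in> Pow A \<Longrightarrow> s \<in> \<Sigma> \<Longrightarrow> 0 \<le> p X s"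
    and marg: "\<And>X. X \<in> Pow A \<Longrightarrow> (\<Sum>s\<in>\<Sigma>. p X s) = 1/2^card A"
  shows "(\<Sum>s\<in>\<Sigma>. (\<Sum>S | S \<subseteq> A \<and> card S = k. (\<Sum>X\<in>Pow A. p X s * walsh S X)\<^sup>2)
      / (\<Sum>X\<in>Pow A. p X s)) \<le> 2 * (2 * real r - 1)^k"
proof -
  define R where "R = 2 * real r - 1"
  have R: "R \<ge> 1" using r by (simp add: R_def)
  define a where "a s = (\<Sum>X\<in>Pow A. p X s)" for s
  define W where "W s = (\<Sum>S | S \<subseteq> A \<and> card S = k. (\<Sum>X\<in>Pow A. p X s * walsh S X)\<^sup>2)" for s
  define V where "V s = W s / ((a s)\<^sup>2 * R^k)" for s
  have a0: "a s \<ge> 0" if "s \<in> \<Sigma>" for s using p that by (auto simp: a_def intro!: sum_nonneg)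
  have W0: "W s \<ge> 0" for s by (simp add: W_def sum_nonneg)
  have V0: "V s \<ge> 0" for s using W0 R by (simp add: V_def)
  have suma: "(\<Sum>s\<in>\<Sigma>. a s) = 1"
    unfolding a_def by (subst sum.swap) (simp add: marg card_Pow \<open>finite A\<close>)
  have pb: "p X s \<le> 1/2^card A" if "X \<in> Pow A" "s \<in> \<Sigma>" for X s
    using member_le_sum[of s \<Sigma> "p X"] that p assms(2) marg by auto
  have V1: "a s * (V s)^r \<le> 1" if "s \<in> \<Sigma>" for s
  proof (cases "a s = 0")
    case False
    then have "a s > 0" using a0[OF that] by simp
    then show ?thesis
      unfolding V_def R_def using that p pb
      by (intro level_inequality[OF \<open>finite A\<close> r, where f = "\<lambda>X. p X s"]) (auto simp: a_def W_def)
  qed simp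
  have "(\<Sum>s\<in>\<Sigma>. a s *\<^sub>R V s)^r \<le> (\<Sum>s\<in>\<Sigma>. a s * (V s)^r)"
    using assms(2) suma a0 V0
    by (intro convex_on_sum[OF _ _ convex_power_nonneg]) auto
  also have "\<dots> \<le> (\<Sum>s\<in>\<Sigma>. 1)" using V1 by (intro sum_mono) auto
  also have "\<dots> \<le> 2^r" using assms(3) by (simp add: numeral_power_le_of_nat_cancel_iff)
  finally have "(\<Sum>s\<in>\<Sigma>. a s * V s) \<le> 2"
    using r by (simp add: power_mono_iff sum_nonneg a0 V0)
  \<comment> \<open>States of probability zero cause no trouble: with \<open>x / 0 = 0\<close> both
    summands vanish.\<close>
  moreover have "(\<Sum>s\<in>\<Sigma>. W s / a s) = R^k * (\<Sum>s\<in>\<Sigma>. a s * V s)"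
    unfolding sum_distrib_left V_def using R by (intro sum.cong) (auto simp: power2_eq_square)
  ultimately show ?thesis
    unfolding a_def[symmetric] W_def[symmetric] R_def[symmetric] using R by (simp add: mult.commute mult_left_mono)
qed

section \<open>A hybrid argument for streams\<close>

abbreviation expect :: "'a pmf \<Rightarrow> ('a \<Rightarrow> real) \<Rightarrow> real" where
  "expect p f \<equiv> measure_pmf.expectation p f"

lemma integrable_bounded:
  fixes f :: "'a \<Rightarrow> real"
  assumes "\<And>x. \<bar>f x\<bar> \<le> B"
  shows "integrable (measure_pmf p) f"
  using assms by (intro measure_pmf.integrable_const_bound[where B=B]) auto

lemma expect_bounds:
  assumes "\<And>x. a \<le> f x" "\<And>x. f x \<le> b"
  shows "a \<le> expect p f" "expect p f \<le> b"
proof -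
  have "integrable (measure_pmf p) f"
    using assms by (intro integrable_bounded[where B="max \<bar>a\<bar> \<bar>b\<bar>"]) (smt (verit))
  then show "a \<le> expect p f" "expect p f \<le> b"
    using assms by (auto intro!: measure_pmf.integral_ge_const measure_pmf.integral_le_const)
qed

lemma expect_bind_nonneg:
  assumes "\<And>x. 0 \<le> f x" "\<And>x. f x \<le> B"
  shows "expect (bind_pmf p K) f = expect p (\<lambda>x. expect (K x) f)"
proof -
  have i: "integrable (measure_pmf q) f" for q
    using assms by (intro integrable_bounded[where B=B]) auto
  have b: "0 \<le> expect (K x) f \<and> expect (K x) f \<le> B" for x
    using expect_bounds[of 0 f B] assms by auto
  have "ennreal (expect (bind_pmf p K) f) = (\<integral>\<^sup>+x. ennreal (f x) \<partial>bind_pmf p K)"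
    using assms by (intro nn_integral_eq_integral[symmetric] i) auto
  also have "\<dots> = (\<integral>\<^sup>+x. ennreal (expect (K x) f) \<partial>p)"
    using assms by (simp add: nn_integral_eq_integral[OF i])
  also have "\<dots> = ennreal (expect p (\<lambda>x. expect (K x) f))"
    using b by (intro nn_integral_eq_integral integrable_bounded[where B=B]) auto
  finally show ?thesis
    using b assms by (subst (asm) ennreal_inj) (auto intro!: integral_nonneg_AE)
qed

lemma expect_bind:
  fixes f :: "'b \<Rightarrow> real"
  assumes B: "\<And>x. \<bar>f x\<bar> \<le> B"
  shows "expect (bind_pmf p K) f = expect p (\<lambda>x. expect (K x) f)"
proof -
  have i: "integrable (measure_pmf q) f" for q
    using B by (rule integrable_bounded)
  have "\<bar>expect (K x) f\<bar> \<le> B" for x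
    using expect_bounds[of "-B" f B "K x"] B by (simp add: abs_le_iff) (smt (verit))
  then have i2: "integrable (measure_pmf p) (\<lambda>x. expect (K x) f)"
    by (rule integrable_bounded)
  \<comment> \<open>Shifting by \<open>B\<close> reduces to the nonnegative case, which is settled
    by Tonelli for nonnegative integrals.\<close>
  have "expect (bind_pmf p K) (\<lambda>x. f x + B) = expect p (\<lambda>x. expect (K x) (\<lambda>x. f x + B))"
    using B by (intro expect_bind_nonneg[where B="2*B"]) (smt (verit))+
  then show ?thesis using i i2 by simp
qed

lemma expect_finite:
  fixes f :: "'a \<Rightarrow> real"
  assumes "finite A" "set_pmf p \<subseteq> A"
  shows "expect p f = (\<Sum>x\<in>A. pmf p x * f x)"
  using assms by (subst integral_measure_pmf[of A]) auto

text \<open>The potential of an acceptance probability. Its quadratic term absorbs, by AM-GM, the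
  fluctuation of the acceptance probability in one step, so that a step costs only the
  chi-squared divergence of the constraint from uniform noise rather than its square root.\<close>

definition potential :: "real \<Rightarrow> real \<Rightarrow> real" where
  "potential l u = u - l * u\<^sup>2"

lemma potential_bounds:
  assumes "0 \<le> u" "u \<le> 1" "0 < l" "l \<le> 1/2"
  shows "u - l \<le> potential l u" "potential l u \<le> u" "\<bar>potential l u\<bar> \<le> 1"
proof -
  have "0 \<le> l * u\<^sup>2" "l * u\<^sup>2 \<le> l * 1" using assms by (auto intro!: mult_left_mono power_le_one)
  then show "u - l \<le> potential l u" "potential l u \<le> u" "\<bar>potential l u\<bar> \<le> 1"
    using assms unfolding potential_def by linarith+
qed

text \<open>For \<open>l \<le> 1/2\<close> the potential is 1-Lipschitz on the unit interval, and
  AM-GM splits the product of \<open>\<bar>d\<bar>\<close> and \<open>\<bar>u - v\<bar>\<close>.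
  Later \<open>w\<close> is the probability of a state together with a noise constraint, and
  \<open>d\<close> the deviation of the planted probability from it.\<close>

lemma potential_step:
  fixes d w :: real
  assumes uv: "0 \<le> u" "u \<le> 1" "0 \<le> v" "v \<le> 1" and l: "0 < l" "l \<le> 1/2" and w: "w > 0"
  shows "d * (potential l u - potential l v) \<le> l * w * (u - v)\<^sup>2 + d\<^sup>2 / (4 * l * w)"
proof -
  have "potential l u - potential l v = (u - v) * (1 - l * (u + v))"
    by (simp add: potential_def power2_eq_square algebra_simps)
  moreover have "\<bar>1 - l * (u + v)\<bar> \<le> 1"
  proof -
    have "0 \<le> l * (u + v)" "l * (u + v) \<le> 1"
      using assms mult_mono[of l "1/2" "u + v" 2] by simp_all
    then show ?thesis by auto
  qed
  ultimately have 1: "\<bar>potential l u - potential l v\<bar> \<le> \<bar>u - v\<bar>"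
    by (simp add: abs_mult mult_left_le)
  have "d * (potential l u - potential l v) \<le> \<bar>d\<bar> * \<bar>u - v\<bar>"
    using mult_left_mono[OF 1 abs_ge_zero[of d]] abs_ge_self[of "d * (potential l u - potential l v)"]
    by (simp add: abs_mult)
  also have "\<dots> \<le> l * w * (u - v)\<^sup>2 + d\<^sup>2 / (4 * l * w)"
  proof -
    have "0 \<le> (2 * l * w * \<bar>u - v\<bar> - \<bar>d\<bar>)\<^sup>2" by simp
    then have "4 * (l * w) * (\<bar>d\<bar> * \<bar>u - v\<bar>) \<le> 4 * (l * w) * (l * w * (u - v)\<^sup>2) + d\<^sup>2"
      by (simp add: power2_diff power_mult_distrib) (simp add: power2_eq_square algebra_simps)
    then show ?thesis using l w by (simp add: field_simps)
  qed
  finally show ?thesis .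
qed

text \<open>The constraint is drawn given the hidden \<open>x\<close>, used for one memory update
  and then forgotten; only what the memory retains about \<open>x\<close> matters
  afterwards.\<close>

definition observe :: "('x \<Rightarrow> 'c pmf) \<Rightarrow> ('s \<Rightarrow> 'c \<Rightarrow> 's pmf) \<Rightarrow> ('x \<times> 's) pmf \<Rightarrow> ('x \<times> 's) pmf" where
  "observe P K J = bind_pmf J (\<lambda>(x, s). bind_pmf (P x) (\<lambda>c. map_pmf (Pair x) (K s c)))"

text \<open>The chi-squared divergence of the next constraint, conditioned on the memory state, from
  the uniform law on \<open>C\<close>, averaged over the states. Conditioning divides the inner sum
  by the mass of \<open>s\<close>; averaging restores one of the two factors. Null states contribute
  0.\<close>

definition chi2 :: "'x set \<Rightarrow> 's set \<Rightarrow> 'c set \<Rightarrow> ('x \<Rightarrow> 'c pmf) \<Rightarrow> ('x \<times> 's) pmf \<Rightarrow> real" where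
  "chi2 A \<Sigma> C P J = (\<Sum>s\<in>\<Sigma>. \<Sum>c\<in>C. real (card C) *
      (\<Sum>x\<in>A. pmf J (x, s) * (pmf (P x) c - 1 / card C))\<^sup>2 / (\<Sum>x\<in>A. pmf J (x, s)))"

lemma expect_observe:
  fixes f :: "'s \<Rightarrow> real"
  assumes B: "\<And>s. \<bar>f s\<bar> \<le> B"
    and fin: "finite A" "finite \<Sigma>" "finite C" and J: "set_pmf J \<subseteq> A \<times> \<Sigma>"
    and P: "\<And>x. x \<in> A \<Longrightarrow> set_pmf (P x) \<subseteq> C"
  shows "expect (observe P K J) (\<lambda>z. f (snd z)) =
    (\<Sum>s\<in>\<Sigma>. \<Sum>c\<in>C. (\<Sum>x\<in>A. pmf J (x, s) * pmf (P x) c) * expect (K s c) f)"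
proof -
  have Bs: "\<And>z. \<bar>f (snd z)\<bar> \<le> B" using B by simp
  have "expect (observe P K J) (\<lambda>z. f (snd z)) =
      expect J (\<lambda>(x, s). expect (P x) (\<lambda>c. expect (K s c) f))"
    unfolding observe_def
    by (simp add: expect_bind[OF Bs] case_prod_unfold)
  also have "\<dots> = (\<Sum>(x,s)\<in>A\<times>\<Sigma>. pmf J (x, s) * expect (P x) (\<lambda>c. expect (K s c) f))"
    using J fin by (subst expect_finite[of "A \<times> \<Sigma>"]) (auto simp: case_prod_beta)
  also have "\<dots> = (\<Sum>(x,s)\<in>A\<times>\<Sigma>. pmf J (x, s) * (\<Sum>c\<in>C. pmf (P x) c * expect (K s c) f))"
    using P fin by (intro sum.cong) (auto simp: expect_finite)
  also have "\<dots> = (\<Sum>x\<in>A. \<Sum>s\<in>\<Sigma>. \<Sum>c\<in>C. pmf J (x, s) * pmf (P x) c * expect (K s c) f)"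
    by (subst sum.cartesian_product[symmetric]) (simp add: sum_distrib_left mult.assoc)
  also have "\<dots> = (\<Sum>s\<in>\<Sigma>. \<Sum>c\<in>C. \<Sum>x\<in>A. pmf J (x, s) * pmf (P x) c * expect (K s c) f)"
    by (subst sum.swap) (intro sum.cong refl sum.swap)
  finally show ?thesis by (simp add: sum_distrib_right)
qed

text \<open>Given a state, the planted law is the uniform one plus a deviation \<open>d\<close>.
  Applying \<open>potential_step\<close> with \<open>w = q * a s\<close> charges the deviation
  partly to \<open>chi2\<close>, partly to the variance of \<open>h\<close> around
  \<open>g s\<close>. Under uniform noise the concave potential drops on average by exactly
  \<open>l\<close> times that variance, so the second charge cancels.\<close>

lemma observe_potential_le:
  fixes h :: "'s \<Rightarrow> real" and P :: "'x \<Rightarrow> 'c pmf" and K :: "'s \<Rightarrow> 'c \<Rightarrow> 's pmf"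
  assumes h: "\<And>s. 0 \<le> h s" "\<And>s. h s \<le> 1" and l: "0 < l" "l \<le> 1/2"
    and fin: "finite A" "finite \<Sigma>" "finite C" "C \<noteq> {}" and J: "set_pmf J \<subseteq> A \<times> \<Sigma>"
    and P: "\<And>x. x \<in> A \<Longrightarrow> set_pmf (P x) \<subseteq> C"
  defines "g \<equiv> \<lambda>s. expect (bind_pmf (pmf_of_set C) (K s)) h"
  shows "expect (observe P K J) (\<lambda>z. potential l (h (snd z)))
    \<le> expect J (\<lambda>z. potential l (g (snd z))) + chi2 A \<Sigma> C P J / (4 * l)"
proof -
  define q where "q = 1 / real (card C)"
  have q: "q > 0" using fin by (simp add: q_def card_gt_0_iff)
  have habs: "\<bar>h s\<bar> \<le> 1" for s using h[of s] by simp
  have pabs: "\<bar>potential l (h s)\<bar> \<le> 1" for s using potential_bounds[OF h l] by simp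
  have g: "g s = (\<Sum>c\<in>C. q * expect (K s c) h)" for s
    unfolding g_def expect_bind[OF habs] using fin
    by (subst expect_finite[of C]) (auto simp: q_def)
  have g01: "0 \<le> g s" "g s \<le> 1" for s unfolding g_def using expect_bounds[of 0 h 1] h by auto
  define a where "a s = (\<Sum>x\<in>A. pmf J (x, s))" for s
  define d where "d s c = (\<Sum>x\<in>A. pmf J (x, s) * (pmf (P x) c - q))" for s c
  have a0: "a s \<ge> 0" for s by (simp add: a_def sum_nonneg)
  \<comment> \<open>Both laws have total mass 1; hence the constant \<open>potential l (g s)\<close>
    can be subtracted in the sums weighted by \<open>d\<close>.\<close>
  have dsum: "(\<Sum>c\<in>C. d s c) = 0" for s
  proof -
    have "(\<Sum>c\<in>C. d s c) = (\<Sum>x\<in>A. pmf J (x, s) * ((\<Sum>c\<in>C. pmf (P x) c) - 1))"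
      unfolding d_def using fin
      by (subst sum.swap) (simp add: sum_distrib_left[symmetric] sum_subtractf q_def)
    also have "\<dots> = 0" using P fin by (intro sum.neutral) (auto simp: sum_pmf_eq_1)
    finally show ?thesis .
  qed
  have step: "(\<Sum>c\<in>C. (\<Sum>x\<in>A. pmf J (x, s) * pmf (P x) c) * expect (K s c) (\<lambda>s. potential l (h s)))
     \<le> a s * potential l (g s) + (\<Sum>c\<in>C. (d s c)\<^sup>2 / (q * a s)) / (4 * l)" for s
  proof (cases "a s = 0")
    case True
    then have "\<forall>x\<in>A. pmf J (x, s) = 0"
      using fin unfolding a_def by (subst (asm) sum_nonneg_eq_0_iff) auto
    then show ?thesis using True by simp
  next
    case False
    then have as: "a s > 0" using a0[of s] by simp
    let ?E = "\<lambda>c. expect (K s c) (\<lambda>s. potential l (h s))"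
    let ?V = "\<lambda>c. expect (K s c) (\<lambda>t. (h t - g s)\<^sup>2)"
    have i: "integrable (measure_pmf p) h" "integrable (measure_pmf p) (\<lambda>t. potential l (h t))"
       "integrable (measure_pmf p) (\<lambda>t. (h t - g s)\<^sup>2)" for p
    proof -
      have "\<bar>(h t - g s)\<^sup>2\<bar> \<le> 1" for t
        using h[of t] g01[of s] by (auto simp: abs_square_le_1)
      then show "integrable (measure_pmf p) (\<lambda>t. (h t - g s)\<^sup>2)" by (rule integrable_bounded)
      show "integrable (measure_pmf p) h" "integrable (measure_pmf p) (\<lambda>t. potential l (h t))"
        using habs pabs by (auto intro: integrable_bounded)
    qed
    have 1: "d s c * (?E c - potential l (g s)) \<le> l * (q * a s) * ?V c + (d s c)\<^sup>2 / (4 * l * (q * a s))" for c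
    proof -
      have "d s c * (?E c - potential l (g s)) = expect (K s c) (\<lambda>t. d s c * (potential l (h t) - potential l (g s)))"
        using i by simp
      also have "\<dots> \<le> expect (K s c) (\<lambda>t. l * (q * a s) * (h t - g s)\<^sup>2 + (d s c)\<^sup>2 / (4 * l * (q * a s)))"
        using i q as by (intro integral_mono potential_step h g01 l) auto
      also have "\<dots> = l * (q * a s) * ?V c + (d s c)\<^sup>2 / (4 * l * (q * a s))"
        using i by simp
      finally show ?thesis .
    qed
    \<comment> \<open>The squares of \<open>h t\<close> cancel and leave an expression affine in
      \<open>h t\<close>, whose noise average is \<open>potential l (g s)\<close>.\<close>
    have 2: "?E c + l * ?V c = expect (K s c) h * (1 - 2 * l * g s) + l * (g s)\<^sup>2" for c
    proof -
      have "?E c + l * ?V c = expect (K s c) (\<lambda>t. potential l (h t) + l * (h t - g s)\<^sup>2)"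
        using i by simp
      also have "\<dots> = expect (K s c) (\<lambda>t. h t * (1 - 2 * l * g s) + l * (g s)\<^sup>2)"
        by (simp add: potential_def power2_eq_square algebra_simps)
      also have "\<dots> = expect (K s c) h * (1 - 2 * l * g s) + l * (g s)\<^sup>2"
        using i by simp
      finally show ?thesis .
    qed
    have P: "(\<Sum>x\<in>A. pmf J (x, s) * pmf (P x) c) = d s c + a s * q" for c
      by (simp add: d_def a_def right_diff_distrib sum_subtractf sum_distrib_right)
    have "(\<Sum>c\<in>C. (\<Sum>x\<in>A. pmf J (x, s) * pmf (P x) c) * ?E c)
       = (\<Sum>c\<in>C. d s c * (?E c - potential l (g s)) + a s * q * ?E c)"
      using dsum[of s] unfolding P by (simp add: algebra_simps sum.distrib sum_subtractf sum_distrib_right[symmetric])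
    also have "\<dots> \<le> (\<Sum>c\<in>C. (l * (q * a s) * ?V c + (d s c)\<^sup>2 / (4 * l * (q * a s))) + a s * q * ?E c)"
      using 1 by (intro sum_mono add_right_mono) auto
    also have "\<dots> = (\<Sum>c\<in>C. a s * q * (?E c + l * ?V c) + ((d s c)\<^sup>2 / (q * a s)) / (4 * l))"
      by (intro sum.cong) (auto simp: algebra_simps)
    also have "\<dots> = a s * (\<Sum>c\<in>C. q * expect (K s c) h * (1 - 2 * l * g s) + q * (l * (g s)\<^sup>2)) + (\<Sum>c\<in>C. (d s c)\<^sup>2 / (q * a s)) / (4 * l)"
      unfolding 2 sum.distrib[of _ "\<lambda>c. (d s c)\<^sup>2 / (q * a s) / (4 * l)"] sum_divide_distrib[symmetric] sum_distrib_left
      by (simp only: distrib_left mult_ac)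
    also have "(\<Sum>c\<in>C. q * expect (K s c) h * (1 - 2 * l * g s) + q * (l * (g s)\<^sup>2)) = potential l (g s)"
    proof -
      have "(\<Sum>c\<in>C. q * expect (K s c) h * (1 - 2 * l * g s) + q * (l * (g s)\<^sup>2))
          = g s * (1 - 2 * l * g s) + real (card C) * (q * (l * (g s)\<^sup>2))"
        by (simp add: sum.distrib sum_distrib_right[symmetric] g[symmetric])
      also have "\<dots> = potential l (g s)"
        using q by (simp add: q_def potential_def power2_eq_square algebra_simps)
      finally show ?thesis .
    qed
    finally show ?thesis .
  qed
  have "expect (observe P K J) (\<lambda>z. potential l (h (snd z))) =
     (\<Sum>s\<in>\<Sigma>. \<Sum>c\<in>C. (\<Sum>x\<in>A. pmf J (x, s) * pmf (P x) c) * expect (K s c) (\<lambda>s. potential l (h s)))"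
    using fin P J by (intro expect_observe[OF pabs]) auto
  also have "\<dots> \<le> (\<Sum>s\<in>\<Sigma>. a s * potential l (g s) + (\<Sum>c\<in>C. (d s c)\<^sup>2 / (q * a s)) / (4 * l))"
    using step by (rule sum_mono)
  also have "\<dots> = (\<Sum>s\<in>\<Sigma>. \<Sum>x\<in>A. pmf J (x, s) * potential l (g s)) + chi2 A \<Sigma> C P J / (4 * l)"
  proof -
    have "chi2 A \<Sigma> C P J = (\<Sum>s\<in>\<Sigma>. \<Sum>c\<in>C. (d s c)\<^sup>2 / (q * a s))"
      unfolding chi2_def a_def[symmetric] q_def[symmetric] d_def[symmetric]
      by (intro sum.cong) (auto simp: q_def)
    then show ?thesis
      by (simp only: sum.distrib sum_divide_distrib a_def sum_distrib_right)
  qed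
  also have "(\<Sum>s\<in>\<Sigma>. \<Sum>x\<in>A. pmf J (x, s) * potential l (g s)) = expect J (\<lambda>z. potential l (g (snd z)))"
    using fin J by (subst sum.swap, subst expect_finite[of "A \<times> \<Sigma>"]) (auto simp: sum.cartesian_product case_prod_beta)
  finally show ?thesis .
qed

fun observe_iter :: "('x \<Rightarrow> 'c pmf) \<Rightarrow> ('s \<Rightarrow> 'c \<Rightarrow> 's pmf) \<Rightarrow> nat \<Rightarrow> ('x \<times> 's) pmf \<Rightarrow> ('x \<times> 's) pmf" where
  "observe_iter P K 0 J = J"
| "observe_iter P K (Suc m) J = observe_iter P K m (observe P K J)"

text \<open>Recursion backwards in time: a hybrid replaces the current constraint while all later
  ones are already noise, so this is the test function of that step.\<close>

fun noise_accept :: "'c set \<Rightarrow> ('s \<Rightarrow> 'c \<Rightarrow> 's pmf) \<Rightarrow> ('s \<Rightarrow> real) \<Rightarrow> nat \<Rightarrow> 's \<Rightarrow> real" where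
  "noise_accept C K h 0 s = h s"
| "noise_accept C K h (Suc m) s = expect (bind_pmf (pmf_of_set C) (K s)) (noise_accept C K h m)"

lemma noise_accept_bounds:
  assumes "\<And>s. 0 \<le> h s" "\<And>s. h s \<le> 1"
  shows "0 \<le> noise_accept C K h m s" "noise_accept C K h m s \<le> 1"
proof (induction m arbitrary: s)
  case (Suc m)
  case 1 show ?case using expect_bounds(1)[of 0 "noise_accept C K h m" 1] Suc by simp
  case 2 show ?case using expect_bounds(2)[of 0 "noise_accept C K h m" 1] Suc by simp
qed (use assms in auto)

text \<open>The potential bounds acceptance only from above; this identity transfers the bound to
  rejection.\<close>

lemma noise_accept_compl:
  assumes "\<And>s. 0 \<le> h s" "\<And>s. h s \<le> 1"
  shows "noise_accept C K (\<lambda>s. 1 - h s) m s = 1 - noise_accept C K h m s"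
proof (induction m arbitrary: s)
  case (Suc m)
  have i: "integrable (measure_pmf p) (noise_accept C K h m)" for p
  proof (rule integrable_bounded)
    show "\<bar>noise_accept C K h m s\<bar> \<le> 1" for s
      using noise_accept_bounds[of h C K m s, OF assms] by simp
  qed
  have "noise_accept C K (\<lambda>s. 1 - h s) m = (\<lambda>s. 1 - noise_accept C K h m s)" using Suc by auto
  then show ?case using i by simp
qed simp

lemma set_pmf_observe:
  "set_pmf (observe P K J) = (\<Union>(x,s)\<in>set_pmf J. \<Union>c\<in>set_pmf (P x). Pair x ` set_pmf (K s c))"
  by (auto simp: observe_def case_prod_beta)

lemma map_fst_observe: "map_pmf fst (observe P K J) = map_pmf fst J"
  by (simp add: observe_def map_bind_pmf pmf.map_comp case_prod_beta o_def map_pmf_const bind_return_pmf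
      bind_pmf_const map_pmf_def[symmetric])

text \<open>The induction hypothesis exchanges all constraints after the first for noise, and
  \<open>observe_potential_le\<close> with test \<open>noise_accept\<close> exchanges the first. The
  marginal of the hidden assignment never changes, so one bound \<open>\<kappa>\<close> serves every
  step. \<open>R i\<close> stands for reachability after \<open>i\<close> updates; it confines the
  memory to \<open>\<Sigma>\<close> only up to time \<open>N\<close>, as a space bound on short
  streams does.\<close>

lemma observe_iter_potential_le:
  fixes h :: "'s \<Rightarrow> real" and P :: "'x \<Rightarrow> 'c pmf" and K :: "'s \<Rightarrow> 'c \<Rightarrow> 's pmf"
  assumes h: "\<And>s. 0 \<le> h s" "\<And>s. h s \<le> 1" and l: "0 < l" "l \<le> 1/2"
    and fin: "finite A" "finite \<Sigma>" "finite C" "C \<noteq> {}"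
    and P: "\<And>x. x \<in> A \<Longrightarrow> set_pmf (P x) \<subseteq> C"
    and chi: "\<And>J. set_pmf J \<subseteq> A \<times> \<Sigma> \<Longrightarrow> map_pmf fst J = D \<Longrightarrow> chi2 A \<Sigma> C P J \<le> \<kappa>"
    and R: "\<And>i s c t. R i s \<Longrightarrow> c \<in> C \<Longrightarrow> t \<in> set_pmf (K s c) \<Longrightarrow> R (Suc i) t"
    and R\<Sigma>: "\<And>i s. R i s \<Longrightarrow> i \<le> N \<Longrightarrow> s \<in> \<Sigma>"
    and J: "set_pmf J \<subseteq> A \<times> {s. R i s}" "map_pmf fst J = D" "i + m \<le> N"
  shows "expect (observe_iter P K m J) (\<lambda>z. potential l (h (snd z)))
    \<le> expect J (\<lambda>z. potential l (noise_accept C K h m (snd z))) + real m * \<kappa> / (4 * l)"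
  using J
proof (induction m arbitrary: J i)
  case 0
  then show ?case by simp
next
  case (Suc m)
  have "set_pmf (observe P K J) \<subseteq> A \<times> {s. R (Suc i) s}"
    using Suc.prems(1) R P unfolding set_pmf_observe by fastforce
  then have "expect (observe_iter P K (Suc m) J) (\<lambda>z. potential l (h (snd z)))
     \<le> expect (observe P K J) (\<lambda>z. potential l (noise_accept C K h m (snd z))) + real m * \<kappa> / (4 * l)"
    using Suc.IH[of "observe P K J" "Suc i"] Suc.prems by (simp add: map_fst_observe)
  also have J\<Sigma>: "set_pmf J \<subseteq> A \<times> \<Sigma>" using Suc.prems R\<Sigma>[of i] by auto
  then have "expect (observe P K J) (\<lambda>z. potential l (noise_accept C K h m (snd z)))
     \<le> expect J (\<lambda>z. potential l (noise_accept C K h (Suc m) (snd z))) + chi2 A \<Sigma> C P J / (4 * l)"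
    using observe_potential_le[where h = "noise_accept C K h m" and K = K, OF noise_accept_bounds[of h, OF h] l fin J\<Sigma> P] by simp
  also have "chi2 A \<Sigma> C P J / (4 * l) \<le> \<kappa> / (4 * l)"
    using chi[OF J\<Sigma>] Suc.prems l by (intro divide_right_mono) auto
  finally show ?case by (simp add: add_divide_distrib ring_distribs)
qed

section \<open>Symmetric distributions given by layer masses\<close>

lemma cube_0: "cube 0 = {[]}"
  by (auto simp: cube_def)

lemma cube_Suc: "cube (Suc k) = (#) (-1) ` cube k \<union> (#) 1 ` cube k"
  by (auto simp: cube_def length_Suc_conv image_iff)

lemma finite_cube: "finite (cube k)"
  by (induction k) (auto simp: cube_0 cube_Suc)

lemma ones_Nil [simp]: "ones [] = 0"
  by (simp add: ones_def)

lemma ones_eq_filter: "ones x = length (filter (\<lambda>a. a = 1) x)"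
  by (simp add: ones_def length_filter_conv_card)

lemma ones_Cons [simp]: "ones (a # x) = (if a = 1 then Suc (ones x) else ones x)"
  by (simp add: ones_eq_filter)

lemma ones_le: "x \<in> cube k \<Longrightarrow> ones x \<le> k"
  by (auto simp: ones_eq_filter cube_def)

definition layer :: "nat \<Rightarrow> nat \<Rightarrow> int list set" where
  "layer k i = {x \<in> cube k. ones x = i}"

lemma finite_layer: "finite (layer k i)"
  using finite_cube by (simp add: layer_def)

lemma layer_nonempty:
  assumes "i \<le> k"
  shows "layer k i \<noteq> {}"
proof -
  have "replicate i 1 @ replicate (k - i) (-1) \<in> layer k i"
    using assms by (auto simp: layer_def cube_def ones_eq_filter)
  then show ?thesis by blast
qed

lemma card_layer_pos: "i \<le> k \<Longrightarrow> card (layer k i) > 0"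
  using layer_nonempty finite_layer by (simp add: card_gt_0_iff)

lemma sum_cube_layers:
  fixes f :: "int list \<Rightarrow> real"
  shows "(\<Sum>x\<in>cube k. f x) = (\<Sum>i<Suc k. \<Sum>x\<in>layer k i. f x)"
  unfolding layer_def using finite_cube ones_le
  by (intro sum.group[symmetric]) (auto simp: less_Suc_eq_le)

lemma layer_mass_eq_sum:
  assumes "set_pmf D \<subseteq> cube k"
  shows "layer_mass D i = (\<Sum>x\<in>layer k i. pmf D x)"
proof -
  have "layer_mass D i = measure_pmf.prob D (layer k i)"
    unfolding layer_mass_def using assms
    by (intro measure_pmf.finite_measure_eq_AE) (auto simp: AE_measure_pmf_iff layer_def)
  then show ?thesis using finite_layer by (simp add: measure_measure_pmf_finite)
qed

lemma layer_mass_Delta: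
  assumes "D \<in> Delta k" "x \<in> cube k"
  shows "pmf D x = layer_mass D (ones x) / card (layer k (ones x))"
proof -
  have "layer_mass D (ones x) = (\<Sum>y\<in>layer k (ones x). pmf D y)"
    using assms by (intro layer_mass_eq_sum) (auto simp: Delta_def)
  also have "\<dots> = (\<Sum>y\<in>layer k (ones x). pmf D x)"
  proof (intro sum.cong refl)
    fix y assume "y \<in> layer k (ones x)"
    then have "y \<in> cube k" "ones y = ones x" by (auto simp: layer_def)
    then show "pmf D y = pmf D x" using assms unfolding Delta_def by blast
  qed
  finally show ?thesis using card_layer_pos[OF ones_le[OF assms(2)]] by simp
qed

text \<open>Symmetry spreads each layer mass evenly over its layer. This is the uniqueness that the
  definite description in \<open>dist_of\<close> requires.\<close>

lemma Delta_eqI: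
  assumes "D \<in> Delta k" "D' \<in> Delta k" "masses k D = masses k D'"
  shows "D = D'"
proof (rule pmf_eqI)
  fix x
  show "pmf D x = pmf D' x"
  proof (cases "x \<in> cube k")
    case True
    have "ones x < Suc k" using ones_le[OF True] by simp
    then have "masses k D ! ones x = layer_mass D (ones x)" "masses k D' ! ones x = layer_mass D' (ones x)"
      unfolding masses_def by (simp_all del: upt_Suc)
    then have "layer_mass D (ones x) = layer_mass D' (ones x)" using assms(3) by simp
    then show ?thesis using layer_mass_Delta[OF assms(1) True] layer_mass_Delta[OF assms(2) True] by simp
  next
    case False
    then have "x \<notin> set_pmf D" "x \<notin> set_pmf D'" using assms by (auto simp: Delta_def)
    then show ?thesis by (simp add: set_pmf_iff)
  qed
qed

lemma ex_Delta_masses: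
  assumes "length p = Suc k" "\<And>i. i < Suc k \<Longrightarrow> 0 \<le> p ! i" "sum_list p = 1"
  shows "\<exists>D. D \<in> Delta k \<and> masses k D = p"
proof -
  define w where "w x = (if x \<in> cube k then p ! ones x / card (layer k (ones x)) else 0)" for x
  have w0: "0 \<le> w x" for x using assms ones_le[of x k] by (simp add: w_def less_Suc_eq_le)
  have layer: "(\<Sum>x\<in>layer k i. w x) = p ! i" if "i < Suc k" for i
  proof -
    have "(\<Sum>x\<in>layer k i. w x) = (\<Sum>x\<in>layer k i. p ! i / card (layer k i))"
      by (intro sum.cong) (auto simp: w_def layer_def)
    then show ?thesis using card_layer_pos[of i k] that by simp
  qed
  have "(\<integral>\<^sup>+x. ennreal (w x) \<partial>count_space UNIV) = (\<Sum>x\<in>cube k. ennreal (w x))"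
    by (intro nn_integral_count_space') (auto simp: w_def finite_cube)
  also have "\<dots> = ennreal (\<Sum>i<Suc k. p ! i)"
    using w0 layer by (simp add: sum_ennreal sum_cube_layers del: sum.lessThan_Suc)
  also have "(\<Sum>i<Suc k. p ! i) = 1"
    using assms by (simp add: sum_list_sum_nth atLeast0LessThan del: sum.lessThan_Suc)
  finally have emb: "pmf (embed_pmf w) x = w x" for x
    using w0 by (intro pmf_embed_pmf) auto
  have supp: "set_pmf (embed_pmf w) \<subseteq> cube k"
    using emb by (auto simp: set_pmf_iff w_def split: if_splits)
  then have "embed_pmf w \<in> Delta k" by (auto simp: Delta_def emb w_def)
  moreover have "masses k (embed_pmf w) = p"
    using assms(1) layer by (intro nth_equalityI)
      (auto simp: masses_def layer_mass_eq_sum[OF supp] emb simp del: upt_Suc)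
  ultimately show ?thesis by blast
qed

lemma dist_of_properties:
  assumes "length p = Suc k" "\<And>i. i < Suc k \<Longrightarrow> 0 \<le> p ! i" "sum_list p = 1"
  shows "dist_of k p \<in> Delta k" "masses k (dist_of k p) = p"
proof -
  obtain D where D: "D \<in> Delta k" "masses k D = p" using ex_Delta_masses[OF assms] by blast
  then have "dist_of k p = D"
    unfolding dist_of_def by (intro the_equality) (auto intro: Delta_eqI)
  with D show "dist_of k p \<in> Delta k" "masses k (dist_of k p) = p" by auto
qed

lemma pmf_dist_of:
  assumes "length p = Suc k" "\<And>i. i < Suc k \<Longrightarrow> 0 \<le> p ! i" "sum_list p = 1"
  shows "pmf (dist_of k p) x = (if x \<in> cube k then p ! ones x / card (layer k (ones x)) else 0)"
proof (cases "x \<in> cube k")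
  case True
  have "ones x < Suc k" using ones_le[OF True] by simp
  then have "layer_mass (dist_of k p) (ones x) = p ! ones x"
    using arg_cong[OF dist_of_properties(2)[OF assms], of "\<lambda>q. q ! ones x"]
    unfolding masses_def by (simp del: upt_Suc)
  then show ?thesis using layer_mass_Delta[OF dist_of_properties(1)[OF assms] True] True by simp
next
  case False
  then have "x \<notin> set_pmf (dist_of k p)"
    using dist_of_properties(1)[OF assms] by (auto simp: Delta_def)
  then show ?thesis using False by (simp add: set_pmf_iff)
qed

lemma nth_5_nonneg:
  assumes "0 \<le> a" "0 \<le> b" "0 \<le> c" "0 \<le> d" "0 \<le> (e::real)" "i < Suc 4"
  shows "0 \<le> [a, b, c, d, e] ! i"
  using assms by (auto simp: less_Suc_eq numeral_eq_Suc)

lemma star_properties: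
  "D_N_star \<in> Delta 4" "masses 4 D_N_star = [0, 0, 4/5, 1/5, 0]"
  "D_Y_star \<in> Delta 4" "masses 4 D_Y_star = [4/15, 0, 0, 11/15, 0]"
  "D_0 \<in> Delta 4" "masses 4 D_0 = [0, 0, 0, 1, 0]"
  "D_N_prime \<in> Delta 4" "masses 4 D_N_prime = [0, 0, 1, 0, 0]"
  "D_Y_prime \<in> Delta 4" "masses 4 D_Y_prime = [1/3, 0, 0, 2/3, 0]"
  unfolding D_N_star_def D_Y_star_def D_0_def D_N_prime_def D_Y_prime_def
  by (intro dist_of_properties nth_5_nonneg; simp)+

lemma pmf_star:
  "pmf D_N_star x = (if x \<in> cube 4 then [0, 0, 4/5, 1/5, 0] ! ones x / card (layer 4 (ones x)) else 0)"
  "pmf D_Y_star x = (if x \<in> cube 4 then [4/15, 0, 0, 11/15, 0] ! ones x / card (layer 4 (ones x)) else 0)"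
  "pmf D_0 x = (if x \<in> cube 4 then [0, 0, 0, 1, 0] ! ones x / card (layer 4 (ones x)) else 0)"
  "pmf D_N_prime x = (if x \<in> cube 4 then [0, 0, 1, 0, 0] ! ones x / card (layer 4 (ones x)) else 0)"
  "pmf D_Y_prime x = (if x \<in> cube 4 then [1/3, 0, 0, 2/3, 0] ! ones x / card (layer 4 (ones x)) else 0)"
  unfolding D_N_star_def D_Y_star_def D_0_def D_N_prime_def D_Y_prime_def
  by (intro pmf_dist_of nth_5_nonneg; simp)+

text \<open>All these pmfs divide by the same layer sizes, so it suffices to mix layer masses:
  \<open>4/15 = 4/5 * 1/3\<close>, \<open>11/15 = 1/5 + 4/5 * 2/3\<close>, and
  \<open>D_N_star\<close> has \<open>4/5\<close> and \<open>1/5\<close>.\<close>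

lemma star_mixtures:
  "is_mixture (1/5) D_0 D_Y_prime D_Y_star" "is_mixture (1/5) D_0 D_N_prime D_N_star"
proof -
  have "z \<in> {0, 1, 2, 3, 4}" if "z \<le> 4" for z :: nat using that by auto
  then have "[4/15, 0, 0, 11/15, 0] ! z = 1/5 * [0, 0, 0, 1, 0] ! z + (1 - 1/5) * [1/3, 0, 0, 2/3, 0::real] ! z"
     "[0, 0, 4/5, 1/5, 0] ! z = 1/5 * [0, 0, 0, 1, 0] ! z + (1 - 1/5) * [0, 0, 1, 0, 0::real] ! z"
    if "z \<le> 4" for z :: nat
    using that by fastforce+
  then show "is_mixture (1/5) D_0 D_Y_prime D_Y_star" "is_mixture (1/5) D_0 D_N_prime D_N_star"
    unfolding is_mixture_def pmf_star using ones_le[of _ 4] by (simp_all add: add_divide_distrib)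
qed

lemma cube_4: "cube 4 = set
  [[-1,-1,-1,-1], [-1,-1,-1,1], [-1,-1,1,-1], [-1,-1,1,1], [-1,1,-1,-1], [-1,1,-1,1], [-1,1,1,-1], [-1,1,1,1],
   [1,-1,-1,-1], [1,-1,-1,1], [1,-1,1,-1], [1,-1,1,1], [1,1,-1,-1], [1,1,-1,1], [1,1,1,-1], [1,1,1,1]]"
  by (auto simp: numeral_eq_Suc cube_Suc cube_0)

lemma sum_cube_4:
  fixes f :: "int list \<Rightarrow> real"
  shows "(\<Sum>x\<in>cube 4. f x) = (\<Sum>x\<leftarrow>
  [[-1,-1,-1,-1], [-1,-1,-1,1], [-1,-1,1,-1], [-1,-1,1,1], [-1,1,-1,-1], [-1,1,-1,1], [-1,1,1,-1], [-1,1,1,1],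
   [1,-1,-1,-1], [1,-1,-1,1], [1,-1,1,-1], [1,-1,1,1], [1,1,-1,-1], [1,1,-1,1], [1,1,1,-1], [1,1,1,1]]. f x)"
  unfolding cube_4 by (rule sum.distinct_set_conv_list) simp

lemma card_layer_4: "card (layer 4 0) = 1" "card (layer 4 2) = 6" "card (layer 4 3) = 4"
proof -
  have "real (card (layer 4 i)) = (\<Sum>x\<in>cube 4. if ones x = i then 1 else 0)" for i
    using finite_cube by (simp add: layer_def sum.If_cases Int_def)
  note * = this[unfolded sum_cube_4]
  show "card (layer 4 0) = 1" "card (layer 4 2) = 6" "card (layer 4 3) = 4"
    using *[of 0] *[of 2] *[of 3] by simp_all
qed

text \<open>Symmetry makes every coordinate, not only the first, unbiased.\<close>

lemma prime_unbiased:
  assumes "i < 4"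
  shows "expect D_Y_prime (\<lambda>y. real_of_int (y ! i)) = 0" "expect D_N_prime (\<lambda>y. real_of_int (y ! i)) = 0"
proof -
  have i: "i = 0 \<or> i = 1 \<or> i = 2 \<or> i = 3" using assms by auto
  \<comment> \<open>The layers with two and three ones have 6 and 4 elements, so both the mass 1 and
    the mass \<open>2/3\<close> come to \<open>1/6\<close> per vector.\<close>
  have c: "x \<in> cube 4 \<Longrightarrow> pmf D_Y_prime x = [1/3, 0, 0, 1/6, 0] ! ones x"
    "x \<in> cube 4 \<Longrightarrow> pmf D_N_prime x = [0, 0, 1/6, 0, 0] ! ones x" for x
    using ones_le[of x 4] card_layer_4 by (auto simp: pmf_star less_Suc_eq_le[symmetric] less_Suc_eq numeral_eq_Suc)
  have "expect D_Y_prime (\<lambda>y. real_of_int (y ! i)) = (\<Sum>x\<in>cube 4. [1/3, 0, 0, 1/6, 0] ! ones x * real_of_int (x ! i))"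
    using star_properties by (subst expect_finite[OF finite_cube[of 4]]) (auto simp: Delta_def c intro!: sum.cong)
  also have "\<dots> = 0" unfolding sum_cube_4 using i by auto
  finally show "expect D_Y_prime (\<lambda>y. real_of_int (y ! i)) = 0" .
  have "expect D_N_prime (\<lambda>y. real_of_int (y ! i)) = (\<Sum>x\<in>cube 4. [0, 0, 1/6, 0, 0] ! ones x * real_of_int (x ! i))"
    using star_properties by (subst expect_finite[OF finite_cube[of 4]]) (auto simp: Delta_def c intro!: sum.cong)
  also have "\<dots> = 0" unfolding sum_cube_4 using i by auto
  finally show "expect D_N_prime (\<lambda>y. real_of_int (y ! i)) = 0" .
qed

lemma star_padded_one_wise:
  "padded_one_wise_via 4 (1/5) D_0 D_Y_prime D_N_prime D_Y_star D_N_star"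
  using star_properties star_mixtures prime_unbiased[of 0]
  by (simp add: padded_one_wise_via_def mu_def)

section \<open>Divergence of a planted constraint from noise\<close>

text \<open>The hidden assignment is encoded by the set \<open>X\<close> of variables with value \<open>-1\<close>.\<close>

definition sign :: "nat set \<Rightarrow> nat \<Rightarrow> int" where
  "sign X i = (if i \<in> X then -1 else 1)"

text \<open>For matching lengths this is an involution in \<open>b\<close>: the same map hides
  literal values behind the planted assignment and recovers them from the signs.\<close>

definition twist :: "int list \<Rightarrow> nat set \<Rightarrow> nat list \<Rightarrow> int list" where
  "twist b X j = map2 (\<lambda>s i. s * sign X i) b j"

definition tuples :: "nat \<Rightarrow> nat list set" where
  "tuples n = {j. length j = 4 \<and> distinct j \<and> set j \<subseteq> {..<n}}"

definition unit_constrs :: "nat \<Rightarrow> constr set" where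
  "unit_constrs n = (\<lambda>(b, j). (b, j, 1)) ` (cube 4 \<times> tuples n)"

text \<open>The indices are uniform and independent of \<open>X\<close>; only the signs carry
  information. They are set so that the literals take values distributed as \<open>Y\<close> under
  the hidden assignment.\<close>

definition planted :: "nat \<Rightarrow> int list pmf \<Rightarrow> nat set \<Rightarrow> constr pmf" where
  "planted n Y X = bind_pmf (pmf_of_set (tuples n)) (\<lambda>j. map_pmf (\<lambda>y. (twist y X j, j, 1)) Y)"

lemma length_twist [simp]: "length (twist b X j) = min (length b) (length j)"
  by (simp add: twist_def)

lemma nth_twist: "i < length b \<Longrightarrow> i < length j \<Longrightarrow> twist b X j ! i = b ! i * sign X (j ! i)"
  by (simp add: twist_def)

lemma twist_twist: "length b = length j \<Longrightarrow> twist (twist b X j) X j = b"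
  by (intro nth_equalityI) (auto simp: nth_twist sign_def)

lemma cube_iff_nth: "x \<in> cube k \<longleftrightarrow> length x = k \<and> (\<forall>i<k. x ! i = -1 \<or> x ! i = 1)"
  by (auto simp: cube_def set_conv_nth)

lemma twist_cube: "b \<in> cube k \<Longrightarrow> length j = k \<Longrightarrow> twist b X j \<in> cube k"
  by (auto simp: cube_iff_nth nth_twist sign_def)

lemma finite_tuples: "finite (tuples n)"
  by (rule finite_subset[OF _ finite_lists_length_eq[of "{..<n}" 4]]) (auto simp: tuples_def)

lemma card_tuples: "real (card (tuples (m + 4))) = real (m+4) * real (m+3) * real (m+2) * real (m+1)"
proof -
  have "card (tuples (m + 4)) = \<Prod>{m + 4 - 4 + 1..m + 4}"
    unfolding tuples_def using card_lists_distinct_length_eq[of "{..<m+4}" 4] by simp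
  also have "{m + 4 - 4 + 1..m + 4} = {m+1, m+2, m+3, m+4}" by auto
  finally show ?thesis by (simp add: algebra_simps)
qed

text \<open>From \<open>n = 6\<close> on, each of the factors \<open>n\<close>,
  \<open>n - 1\<close>, \<open>n - 2\<close>, \<open>n - 3\<close> is at least
  \<open>n/2\<close>.\<close>

lemma card_tuples_ge:
  assumes "n \<ge> 6"
  shows "real n^4 \<le> 16 * real (card (tuples n))"
proof -
  define m where "m = n - 4"
  then have m: "n = m + 4" "m \<ge> 2" using assms by auto
  have "real n^4 = real n * real n * (real n * real n)" by (simp add: power4_eq_xxxx)
  also have "\<dots> \<le> (2 * real (m+4)) * (2 * real (m+3)) * ((2 * real (m+2)) * (2 * real (m+1)))"
    using m by (intro mult_mono) auto
  finally show ?thesis using card_tuples[of m] m by (simp add: algebra_simps)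
qed

lemma tuples_nonempty: "n \<ge> 4 \<Longrightarrow> tuples n \<noteq> {}"
  using card_tuples[of "n - 4"] by (auto dest!: arg_cong[where f="\<lambda>A. real (card A)"])

lemma card_cube: "card (cube k) = 2^k"
proof (induction k)
  case (Suc k)
  have "(#) (-1::int) ` cube k \<inter> (#) 1 ` cube k = {}" by auto
  then show ?case using Suc finite_cube by (simp add: cube_Suc card_Un_disjoint card_image)
qed (simp add: cube_0)

lemma finite_unit_constrs: "finite (unit_constrs n)"
  using finite_cube finite_tuples by (simp add: unit_constrs_def)

lemma inj_unit: "inj_on (\<lambda>(b, j). (b, j, 1::real)) A"
  by (auto simp: inj_on_def)

lemma card_unit_constrs: "card (unit_constrs n) = 16 * card (tuples n)"
  by (simp add: unit_constrs_def card_image inj_unit card_cartesian_product card_cube)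

lemma unit_constrs_nonempty: "n \<ge> 4 \<Longrightarrow> unit_constrs n \<noteq> {}"
  using tuples_nonempty card_cube[of 4] by (auto simp: unit_constrs_def)

lemma set_pmf_planted:
  assumes "n \<ge> 4" "set_pmf Y \<subseteq> cube 4"
  shows "set_pmf (planted n Y X) \<subseteq> unit_constrs n"
proof -
  have "twist y X j \<in> cube 4" if "y \<in> set_pmf Y" "j \<in> tuples n" for y j
    using that assms by (auto intro!: twist_cube simp: tuples_def)
  then show ?thesis
    using assms tuples_nonempty finite_tuples by (auto simp: planted_def unit_constrs_def)
qed

lemma pmf_planted:
  assumes n: "n \<ge> 4" and Y: "set_pmf Y \<subseteq> cube 4" and b: "b \<in> cube 4" and j: "j \<in> tuples n"
  shows "pmf (planted n Y X) (b, j, 1) = pmf Y (twist b X j) / card (tuples n)"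
proof -
  have 1: "pmf (map_pmf (\<lambda>y. (twist y X i, i, 1::real)) Y) (b, j, 1) = (if i = j then pmf Y (twist b X j) else 0)" for i
  proof (cases "i = j")
    case True
    have "y = twist b X j" if "y \<in> set_pmf Y" "twist y X j = b" for y
      using that Y j twist_twist[of y j X] by (auto simp: tuples_def cube_def)
    moreover have "twist (twist b X j) X j = b"
      using b j by (intro twist_twist) (auto simp: tuples_def cube_def)
    ultimately have "measure_pmf.prob Y ((\<lambda>y. (twist y X j, j, 1::real)) -` {(b, j, 1)}) = measure_pmf.prob Y {twist b X j}"
      by (intro measure_pmf.finite_measure_eq_AE) (auto simp: AE_measure_pmf_iff)
    then show ?thesis using True by (simp add: pmf_map pmf.rep_eq)
  next
    case False
    then have "(b, j, 1) \<notin> set_pmf (map_pmf (\<lambda>y. (twist y X i, i, 1::real)) Y)" by auto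
    then show ?thesis using False by (simp only: set_pmf_iff) simp
  qed
  show ?thesis
    unfolding planted_def using n j
    by (simp add: pmf_bind_pmf_of_set tuples_nonempty finite_tuples 1)
qed

text \<open>The Fourier coefficient of \<open>Y\<close> at \<open>U\<close>, without the
  normalisation \<open>2^k\<close>.\<close>

definition bias :: "int list pmf \<Rightarrow> nat set \<Rightarrow> real" where
  "bias Y U = expect Y (\<lambda>y. \<Prod>i\<in>U. real_of_int (y ! i))"

lemma abs_prod_cube:
  assumes "y \<in> cube k" "U \<subseteq> {..<k}"
  shows "\<bar>\<Prod>i\<in>U. real_of_int (y ! i)\<bar> = 1"
proof -
  have "\<bar>real_of_int (y ! i)\<bar> = 1" if "i \<in> U" for i
    using that assms by (auto simp: cube_iff_nth)
  then show ?thesis by (simp add: abs_prod)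
qed

lemma abs_bias_le:
  assumes Y: "set_pmf Y \<subseteq> cube k" and U: "U \<subseteq> {..<k}"
  shows "\<bar>bias Y U\<bar> \<le> 1"
proof -
  have "\<bar>bias Y U\<bar> = \<bar>\<Sum>y\<in>cube k. pmf Y y * (\<Prod>i\<in>U. real_of_int (y ! i))\<bar>"
    unfolding bias_def using Y by (subst expect_finite[OF finite_cube]) auto
  also have "\<dots> \<le> (\<Sum>y\<in>cube k. pmf Y y)"
    by (rule order_trans[OF sum_abs]) (auto simp: abs_mult abs_prod_cube[OF _ U])
  also have "\<dots> = 1" using Y finite_cube by (simp add: sum_pmf_eq_1)
  finally show ?thesis .
qed

text \<open>Fourier inversion: the product of the factors \<open>1 + z ! i * y ! i\<close> is
  \<open>2^k\<close> times the indicator of \<open>y = z\<close>, and multiplying it out gives the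
  sum over \<open>U\<close>.\<close>

lemma pmf_cube_expansion:
  assumes Y: "set_pmf Y \<subseteq> cube k" and z: "z \<in> cube k"
  shows "pmf Y z = (\<Sum>U\<in>Pow {..<k}. (\<Prod>i\<in>U. real_of_int (z ! i)) * bias Y U) / 2^k"
proof -
  have ind: "(\<Prod>i<k. real_of_int (z ! i) * real_of_int (y ! i) + 1) = (if y = z then 2^k else 0)" if y: "y \<in> cube k" for y
  proof (cases "y = z")
    case True
    have "(\<Prod>i<k. real_of_int (z ! i) * real_of_int (y ! i) + 1) = (\<Prod>i<k. 2)"
      using True z by (intro prod.cong) (auto simp: cube_iff_nth)
    then show ?thesis using True by simp
  next
    case False
    then obtain i where i: "i < k" "y ! i \<noteq> z ! i" using y z by (metis cube_iff_nth nth_equalityI)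
    moreover have "y ! i = -1 \<or> y ! i = 1" "z ! i = -1 \<or> z ! i = 1"
      using y z i by (auto simp: cube_iff_nth)
    ultimately have "real_of_int (z ! i) * real_of_int (y ! i) + 1 = 0" by auto
    then show ?thesis using False i by (intro trans[OF prod_zero]) auto
  qed
  have "(\<Sum>U\<in>Pow {..<k}. (\<Prod>i\<in>U. real_of_int (z ! i)) * bias Y U)
     = (\<Sum>U\<in>Pow {..<k}. \<Sum>y\<in>cube k. pmf Y y * ((\<Prod>i\<in>U. real_of_int (z ! i) * real_of_int (y ! i)) * (\<Prod>i\<in>{..<k}-U. 1)))"
    unfolding bias_def using Y by (subst expect_finite[OF finite_cube]) (auto simp: sum_distrib_left prod.distrib mult_ac)
  also have "\<dots> = (\<Sum>y\<in>cube k. pmf Y y * (\<Prod>i<k. real_of_int (z ! i) * real_of_int (y ! i) + 1))"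
    by (subst sum.swap) (simp only: prod_add[OF finite_lessThan] sum_distrib_left)
  also have "\<dots> = pmf Y z * 2^k"
    using z finite_cube by (simp add: ind if_distrib[of "(*) _"] sum.delta' cong: if_cong)
  finally show ?thesis by simp
qed

text \<open>The character of \<open>twist b X j\<close> at \<open>U\<close> splits into that of
  \<open>b\<close> and the Walsh function of \<open>X\<close> on the variables at the positions
  \<open>U\<close>. The empty set yields the uniform probability, and singletons vanish by
  unbiasedness.\<close>

lemma planted_expansion:
  assumes n: "n \<ge> 4" and Y: "set_pmf Y \<subseteq> cube 4" and b: "b \<in> cube 4" and j: "j \<in> tuples n"
    and unbiased: "\<And>i. i < 4 \<Longrightarrow> expect Y (\<lambda>y. real_of_int (y ! i)) = 0"
  shows "pmf (planted n Y X) (b, j, 1) - 1 / card (unit_constrs n) =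
    (\<Sum>U | U \<subseteq> {..<4} \<and> 2 \<le> card U. (\<Prod>i\<in>U. real_of_int (b ! i)) * bias Y U * walsh ((!) j ` U) X) / card (unit_constrs n)"
proof -
  have jl: "length j = 4" "distinct j" using j by (auto simp: tuples_def)
  have bl: "length b = 4" using b by (simp add: cube_def)
  have prod: "(\<Prod>i\<in>U. real_of_int (twist b X j ! i)) = (\<Prod>i\<in>U. real_of_int (b ! i)) * walsh ((!) j ` U) X"
    if "U \<subseteq> {..<4}" for U
  proof -
    have "inj_on ((!) j) U" using jl that by (auto intro!: inj_on_nth)
    then have "walsh ((!) j ` U) X = (\<Prod>i\<in>U. real_of_int (sign X (j ! i)))"
      unfolding walsh_def sign_def by (subst prod.reindex) (auto intro!: prod.cong)
    moreover have "(\<Prod>i\<in>U. real_of_int (twist b X j ! i)) = (\<Prod>i\<in>U. real_of_int (b ! i) * real_of_int (sign X (j ! i)))"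
      using that jl bl by (intro prod.cong) (auto simp: nth_twist)
    ultimately show ?thesis by (simp add: prod.distrib)
  qed
  define T where "T U = (\<Prod>i\<in>U. real_of_int (b ! i)) * bias Y U * walsh ((!) j ` U) X" for U
  have "(\<Sum>U\<in>Pow {..<4}. T U) = (\<Sum>U\<in>insert {} {U. U \<subseteq> {..<4} \<and> 2 \<le> card U}. T U)"
  proof (rule sum.mono_neutral_right)
    show "\<forall>U\<in>Pow {..<4} - insert {} {U. U \<subseteq> {..<4} \<and> 2 \<le> card U}. T U = 0"
    proof
      fix U :: "nat set" assume U: "U \<in> Pow {..<4} - insert {} {U. U \<subseteq> {..<4} \<and> 2 \<le> card U}"
      then have "finite U" "U \<noteq> {}" using finite_subset by auto
      then have "card U \<noteq> 0" "\<not> 2 \<le> card U" using U by auto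
      then have "card U = 1" by linarith
      then obtain i where "U = {i}" by (auto simp: card_1_singleton_iff)
      then show "T U = 0" using U unbiased by (auto simp: T_def bias_def)
    qed
  qed auto
  also have "\<dots> = 1 + (\<Sum>U | U \<subseteq> {..<4} \<and> 2 \<le> card U. T U)"
    by (subst sum.insert) (auto simp: T_def bias_def walsh_def)
  finally have T: "(\<Sum>U\<in>Pow {..<4}. T U) = 1 + (\<Sum>U | U \<subseteq> {..<4} \<and> 2 \<le> card U. T U)" .
  have "pmf (planted n Y X) (b, j, 1) = (\<Sum>U\<in>Pow {..<4}. T U) / card (unit_constrs n)"
    using pmf_planted[OF n Y b j] pmf_cube_expansion[OF Y twist_cube[OF b jl(1)]]
    by (simp add: prod T_def mult_ac card_unit_constrs)
  then show ?thesis unfolding T T_def[symmetric] by (simp add: add_divide_distrib)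
qed

section \<open>From Fourier weights to divergence: counting index tuples\<close>

lemma card_lists_nth_in:
  "card {xs. length xs = m \<and> (\<forall>i<m. xs ! i \<in> B i)} = (\<Prod>i<m. card (B i))"
proof (induction m arbitrary: B)
  case 0
  have "{xs. length xs = 0 \<and> (\<forall>i<0. xs ! i \<in> B i)} = {[]}" by auto
  then show ?case by simp
next
  case (Suc m)
  have "{xs. length xs = Suc m \<and> (\<forall>i<Suc m. xs ! i \<in> B i)} =
     (\<lambda>(x, xs). x # xs) ` (B 0 \<times> {xs. length xs = m \<and> (\<forall>i<m. xs ! i \<in> B (Suc i))})"
  proof (intro equalityI subsetI)
    fix xs assume "xs \<in> {xs. length xs = Suc m \<and> (\<forall>i<Suc m. xs ! i \<in> B i)}"
    then obtain y ys where xs: "xs = y # ys" "length ys = m" and B: "\<forall>i<Suc m. (y # ys) ! i \<in> B i"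
      by (auto simp: length_Suc_conv)
    have "y \<in> B 0" using B by auto
    moreover have "\<forall>i<m. ys ! i \<in> B (Suc i)" using B by fastforce
    ultimately show "xs \<in> (\<lambda>(x, xs). x # xs) ` (B 0 \<times> {xs. length xs = m \<and> (\<forall>i<m. xs ! i \<in> B (Suc i))})"
      using xs by auto
  qed (auto simp: less_Suc_eq_0_disj)
  moreover have "inj_on (\<lambda>(x, xs). x # xs) A" for A :: "('a \<times> 'a list) set" by (auto simp: inj_on_def)
  ultimately show ?case
    using Suc[of "\<lambda>i. B (Suc i)"] by (simp add: card_image card_cartesian_product prod.lessThan_Suc_shift del: prod.lessThan_Suc)
qed

text \<open>In a tuple mapping \<open>U\<close> onto \<open>S\<close>, positions in \<open>U\<close>
  take values in \<open>S\<close> and the others at most \<open>n\<close> values each. The constant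
  is \<open>4^4\<close>, bounding \<open>card U ^ card U\<close>.\<close>

lemma sum_tuples_image_le:
  fixes g :: "nat set \<Rightarrow> real"
  assumes g: "\<And>S. 0 \<le> g S" and U: "U \<subseteq> {..<4}"
  shows "(\<Sum>j\<in>tuples n. g ((!) j ` U)) \<le> 256 * real n^(4 - card U) * (\<Sum>S | S \<subseteq> {..<n} \<and> card S = card U. g S)"
proof -
  have fU: "finite U" using U finite_subset by blast
  have cU: "card U \<le> 4" using card_mono[OF _ U] by simp
  let ?V = "{S. S \<subseteq> {..<n} \<and> card S = card U}"
  have im: "(!) j ` U \<in> ?V" if "j \<in> tuples n" for j
  proof -
    have j: "length j = 4" "distinct j" "set j \<subseteq> {..<n}" using that by (auto simp: tuples_def)
    have "\<forall>i\<in>U. i < length j" using U j by auto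
    moreover from this have "inj_on ((!) j) U" using j inj_on_nth by blast
    ultimately show ?thesis using j by (auto simp: card_image) (metis lessThan_iff nth_mem subsetD)
  qed
  have fib: "real (card {j \<in> tuples n. (!) j ` U = S}) \<le> 256 * real n^(4 - card U)" if S: "S \<in> ?V" for S
  proof -
    let ?B = "\<lambda>i. if i \<in> U then S else {..<n}"
    have "finite {xs. length xs = 4 \<and> (\<forall>i<4. xs ! i \<in> ?B i)}"
    proof (rule finite_subset[OF _ finite_lists_length_eq[of "{..<n}" 4]])
      show "{xs. length xs = 4 \<and> (\<forall>i<4. xs ! i \<in> ?B i)} \<subseteq> {xs. set xs \<subseteq> {..<n} \<and> length xs = 4}"
        using S by (auto simp: set_conv_nth split: if_splits)
    qed simp
    moreover have "{j \<in> tuples n. (!) j ` U = S} \<subseteq> {xs. length xs = 4 \<and> (\<forall>i<4. xs ! i \<in> ?B i)}"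
      by (auto simp: tuples_def) (metis lessThan_iff nth_mem subsetD)
    ultimately have "card {j \<in> tuples n. (!) j ` U = S} \<le> card {xs. length xs = 4 \<and> (\<forall>i<4. xs ! i \<in> ?B i)}"
      by (rule card_mono)
    also have "\<dots> = (\<Prod>i<4. card (?B i))" by (rule card_lists_nth_in)
    also have "\<dots> = (\<Prod>i<4. if i \<in> U then card U else n)" using S by (intro prod.cong) auto
    also have "\<dots> = card U^card U * n^(4 - card U)"
      using U fU by (simp add: prod.If_cases Int_absorb1 Diff_eq[symmetric] card_Diff_subset)
    also have "\<dots> \<le> 4^4 * n^(4 - card U)"
      using cU by (intro mult_right_mono order_trans[OF power_mono[of "card U" 4 "card U"] power_increasing]) auto
    finally have "real (card {j \<in> tuples n. (!) j ` U = S}) \<le> real (4^4 * n^(4 - card U))" by (rule of_nat_mono)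
    then show ?thesis by simp
  qed
  have "(\<Sum>j\<in>tuples n. g ((!) j ` U)) = (\<Sum>S\<in>?V. \<Sum>j | j \<in> tuples n \<and> (!) j ` U = S. g ((!) j ` U))"
    using im finite_tuples by (intro sum.group[symmetric]) auto
  also have "\<dots> = (\<Sum>S\<in>?V. real (card {j \<in> tuples n. (!) j ` U = S}) * g S)"
    by (intro sum.cong) auto
  also have "\<dots> \<le> (\<Sum>S\<in>?V. (256 * real n^(4 - card U)) * g S)"
    using fib g by (intro sum_mono mult_right_mono) auto
  finally show ?thesis by (simp add: sum_distrib_left)
qed

text \<open>Cauchy-Schwarz over the at most 16 sets \<open>U\<close> leaves the Fourier weights
  \<open>(F s T)\<^sup>2\<close>. Averaging over tuples gains \<open>n^k\<close> at level
  \<open>k\<close>, while the level inequality costs order \<open>r^k\<close>. The constant is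
  \<open>2^11\<close> per set \<open>U\<close>, times 16 sets, times \<open>16 * 16\<close> from the
  signs and from \<open>card_tuples_ge\<close>.\<close>

lemma chi2_planted_le:
  fixes J :: "(nat set \<times> 's) pmf"
  assumes n: "n \<ge> 6" and Y: "set_pmf Y \<subseteq> cube 4"
    and unbiased: "\<And>i. i < 4 \<Longrightarrow> expect Y (\<lambda>y. real_of_int (y ! i)) = 0"
    and S: "finite \<Sigma>" "card \<Sigma> \<le> 2^r" "1 \<le> r" "2 * r \<le> n"
    and J: "set_pmf J \<subseteq> Pow {..<n} \<times> \<Sigma>" "map_pmf fst J = pmf_of_set (Pow {..<n})"
  shows "chi2 (Pow {..<n}) \<Sigma> (unit_constrs n) (planted n Y) J \<le> 2^23 * (real r / real n)\<^sup>2"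
proof -
  let ?A = "Pow {..<n}"
  let ?I = "{U. U \<subseteq> {..<4::nat} \<and> 2 \<le> card U}"
  define N where "N = real (card (tuples n))"
  define a where "a s = (\<Sum>X\<in>?A. pmf J (X, s))" for s
  define F where "F s T = (\<Sum>X\<in>?A. pmf J (X, s) * walsh T X)" for s T
  have N: "N > 0" using tuples_nonempty[of n] finite_tuples n by (simp add: N_def card_gt_0_iff)
  have C: "real (card (unit_constrs n)) = 16 * N" by (simp add: N_def card_unit_constrs)
  have a0: "a s \<ge> 0" for s by (simp add: a_def sum_nonneg)
  have cI: "card ?I \<le> 16" "finite ?I"
    using card_mono[of "Pow {..<4::nat}" ?I] by (auto simp: card_Pow)
  have d: "(\<Sum>X\<in>?A. pmf J (X, s) * (pmf (planted n Y X) (b, j, 1) - 1 / card (unit_constrs n)))\<^sup>2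
      \<le> (\<Sum>U\<in>?I. (F s ((!) j ` U))\<^sup>2) / (16 * N\<^sup>2)" if b: "b \<in> cube 4" and j: "j \<in> tuples n" for s b j
  proof -
    define \<beta> where "\<beta> U = (\<Prod>i\<in>U. real_of_int (b ! i)) * bias Y U" for U
    have \<beta>: "(\<beta> U)\<^sup>2 \<le> 1" if "U \<in> ?I" for U
      using that abs_prod_cube[OF b, of U] abs_bias_le[OF Y, of U]
      by (auto simp: \<beta>_def abs_mult abs_square_le_1)
    have "(\<Sum>X\<in>?A. pmf J (X, s) * (pmf (planted n Y X) (b, j, 1) - 1 / card (unit_constrs n)))
       = (\<Sum>X\<in>?A. \<Sum>U\<in>?I. \<beta> U * (pmf J (X, s) * walsh ((!) j ` U) X)) / (16 * N)"
      using n by (subst planted_expansion[OF _ Y b j unbiased])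
        (auto simp: C sum_distrib_left sum_divide_distrib \<beta>_def mult_ac)
    also have "\<dots> = (\<Sum>U\<in>?I. \<beta> U * F s ((!) j ` U)) / (16 * N)"
      by (subst sum.swap) (simp add: F_def sum_distrib_left)
    finally have "(\<Sum>X\<in>?A. pmf J (X, s) * (pmf (planted n Y X) (b, j, 1) - 1 / card (unit_constrs n)))\<^sup>2
       = (\<Sum>U\<in>?I. \<beta> U * F s ((!) j ` U))\<^sup>2 / (256 * N\<^sup>2)"
      by (simp add: power_divide power_mult_distrib)
    also have "\<dots> \<le> (16 * (\<Sum>U\<in>?I. (F s ((!) j ` U))\<^sup>2)) / (256 * N\<^sup>2)"
    proof (intro divide_right_mono)
      have "(\<Sum>U\<in>?I. \<beta> U * F s ((!) j ` U))\<^sup>2 \<le> (\<Sum>U\<in>?I. (\<beta> U * F s ((!) j ` U))\<^sup>2) * real (card ?I)"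
        by (rule sum_squared_le_sum_of_squares)
      also have "\<dots> \<le> (\<Sum>U\<in>?I. (F s ((!) j ` U))\<^sup>2) * 16"
        using \<beta> cI by (intro mult_mono sum_mono) (auto simp: power_mult_distrib mult_left_le_one_le sum_nonneg)
      finally show "(\<Sum>U\<in>?I. \<beta> U * F s ((!) j ` U))\<^sup>2 \<le> 16 * (\<Sum>U\<in>?I. (F s ((!) j ` U))\<^sup>2)" by simp
    qed simp
    also have "\<dots> = (\<Sum>U\<in>?I. (F s ((!) j ` U))\<^sup>2) / (16 * N\<^sup>2)" by simp
    finally show ?thesis .
  qed
  have lev: "(\<Sum>s\<in>\<Sigma>. (\<Sum>T | T \<subseteq> {..<n} \<and> card T = k. (F s T)\<^sup>2) / a s) \<le> 2 * (2 * real r)^k" for k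
  proof -
    have "(\<Sum>s\<in>\<Sigma>. (\<Sum>T | T \<subseteq> {..<n} \<and> card T = k. (F s T)\<^sup>2) / a s) \<le> 2 * (2 * real r - 1)^k"
      unfolding F_def a_def
    proof (rule level_inequality_average)
      fix X assume X: "X \<in> Pow {..<n}"
      have "(\<Sum>s\<in>\<Sigma>. pmf J (X, s)) = measure_pmf.prob J (Pair X ` \<Sigma>)"
        using S by (subst measure_measure_pmf_finite) (auto simp: sum.reindex inj_on_def)
      also have "\<dots> = measure_pmf.prob J (fst -` {X})"
        using J(1) by (intro measure_pmf.finite_measure_eq_AE) (auto simp: AE_measure_pmf_iff)
      also have "\<dots> = pmf (map_pmf fst J) X" by (simp add: pmf_map)
      also have "\<dots> = 1 / 2^card {..<n}" using X by (subst J(2), subst pmf_of_set) (auto simp: card_Pow)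
      finally show "(\<Sum>s\<in>\<Sigma>. pmf J (X, s)) = 1 / 2^card {..<n}" .
    qed (use S in auto)
    also have "\<dots> \<le> 2 * (2 * real r)^k" using S by (intro mult_left_mono power_mono) auto
    finally show ?thesis .
  qed
  have "chi2 ?A \<Sigma> (unit_constrs n) (planted n Y) J = (\<Sum>s\<in>\<Sigma>. \<Sum>b\<in>cube 4. \<Sum>j\<in>tuples n.
     (16 * N) * (\<Sum>X\<in>?A. pmf J (X, s) * (pmf (planted n Y X) (b, j, 1) - 1 / card (unit_constrs n)))\<^sup>2 / a s)"
    unfolding chi2_def C[symmetric] a_def
    by (subst (2) unit_constrs_def, subst sum.reindex[OF inj_unit]) (simp add: sum.cartesian_product case_prod_beta)
  also have "\<dots> \<le> (\<Sum>s\<in>\<Sigma>. \<Sum>b\<in>cube 4. \<Sum>j\<in>tuples n. (16 * N) * ((\<Sum>U\<in>?I. (F s ((!) j ` U))\<^sup>2) / (16 * N\<^sup>2)) / a s)"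
    using d N a0 by (intro sum_mono divide_right_mono mult_left_mono) auto
  also have "\<dots> = (\<Sum>s\<in>\<Sigma>. 16 * (\<Sum>j\<in>tuples n. \<Sum>U\<in>?I. (F s ((!) j ` U))\<^sup>2 / a s / N))"
  proof -
    have "(16 * N) * (x / (16 * N\<^sup>2)) / y = x / y / N" for x y
      using N by (simp add: power2_eq_square)
    then show ?thesis by (simp only:) (simp add: card_cube sum_divide_distrib)
  qed
  also have "\<dots> = 16 / N * (\<Sum>U\<in>?I. \<Sum>s\<in>\<Sigma>. (\<Sum>j\<in>tuples n. (F s ((!) j ` U))\<^sup>2) / a s)"
  proof -
    have "(\<Sum>s\<in>\<Sigma>. \<Sum>j\<in>tuples n. \<Sum>U\<in>?I. (F s ((!) j ` U))\<^sup>2 / a s) = (\<Sum>s\<in>\<Sigma>. \<Sum>U\<in>?I. \<Sum>j\<in>tuples n. (F s ((!) j ` U))\<^sup>2 / a s)"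
      by (intro sum.cong refl sum.swap)
    also have "\<dots> = (\<Sum>U\<in>?I. \<Sum>s\<in>\<Sigma>. (\<Sum>j\<in>tuples n. (F s ((!) j ` U))\<^sup>2) / a s)"
      by (subst sum.swap) (simp add: sum_divide_distrib)
    finally have *: "(\<Sum>U\<in>?I. \<Sum>s\<in>\<Sigma>. (\<Sum>j\<in>tuples n. (F s ((!) j ` U))\<^sup>2) / a s)
        = (\<Sum>s\<in>\<Sigma>. \<Sum>j\<in>tuples n. \<Sum>U\<in>?I. (F s ((!) j ` U))\<^sup>2 / a s)" by (rule sym)
    show ?thesis unfolding * sum_distrib_left by (intro sum.cong refl) simp
  qed
  also have "\<dots> \<le> 16 / N * (\<Sum>U\<in>?I. 2^11 * (real n)\<^sup>2 * (real r)\<^sup>2)"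
  proof (intro mult_left_mono sum_mono)
    fix U assume U: "U \<in> ?I"
    then have cU: "2 \<le> card U" "card U \<le> 4" using card_mono[of "{..<4::nat}" U] by auto
    have "(\<Sum>s\<in>\<Sigma>. (\<Sum>j\<in>tuples n. (F s ((!) j ` U))\<^sup>2) / a s)
       \<le> (\<Sum>s\<in>\<Sigma>. (256 * real n^(4 - card U) * (\<Sum>T | T \<subseteq> {..<n} \<and> card T = card U. (F s T)\<^sup>2)) / a s)"
      using U a0 by (intro sum_mono divide_right_mono sum_tuples_image_le[where g = "\<lambda>T. (F _ T)\<^sup>2"]) auto
    also have "\<dots> = 256 * real n^(4 - card U) * (\<Sum>s\<in>\<Sigma>. (\<Sum>T | T \<subseteq> {..<n} \<and> card T = card U. (F s T)\<^sup>2) / a s)"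
      by (simp add: sum_distrib_left)
    also have "\<dots> \<le> 256 * real n^(4 - card U) * (2 * (2 * real r)^card U)"
      using lev by (intro mult_left_mono) auto
    also have "(2 * real r)^card U = (2 * real r)^(card U - 2) * (2 * real r)\<^sup>2"
      using cU by (simp only: power_add[symmetric] le_add_diff_inverse2)
    \<comment> \<open>By \<open>2 * r \<le> n\<close> the surplus factors of levels 3 and 4 become
      powers of \<open>n\<close>, so level 2 dominates.\<close>
    also have "256 * real n^(4 - card U) * (2 * ((2 * real r)^(card U - 2) * (2 * real r)\<^sup>2))
        \<le> 256 * real n^(4 - card U) * (2 * (real n^(card U - 2) * (2 * real r)\<^sup>2))"
      using S by (intro mult_left_mono mult_right_mono power_mono) auto
    also have "\<dots> = 512 * (real n^(4 - card U) * real n^(card U - 2)) * (4 * (real r)\<^sup>2)"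
      by (simp add: power_mult_distrib)
    also have "real n^(4 - card U) * real n^(card U - 2) = (real n)\<^sup>2"
      using cU by (simp flip: power_add)
    finally show "(\<Sum>s\<in>\<Sigma>. (\<Sum>j\<in>tuples n. (F s ((!) j ` U))\<^sup>2) / a s) \<le> 2^11 * (real n)\<^sup>2 * (real r)\<^sup>2"
      by simp
  qed (use N in simp)
  also have "\<dots> \<le> 16 / N * (16 * (2^11 * (real n)\<^sup>2 * (real r)\<^sup>2))"
    unfolding sum_constant using cI N by (intro mult_left_mono mult_right_mono) auto
  also have "\<dots> \<le> 16 / (real n^4 / 16) * (16 * (2^11 * (real n)\<^sup>2 * (real r)\<^sup>2))"
    using card_tuples_ge[OF n] n N by (intro mult_right_mono divide_left_mono) (auto simp: N_def)
  also have "\<dots> = 2^23 * (real r / real n)\<^sup>2"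
    using n by (simp add: field_simps power2_eq_square power4_eq_xxxx)
  finally show ?thesis .
qed

section \<open>Concentration and values of planted constraints\<close>

fun seq_pmf :: "'c pmf list \<Rightarrow> 'c list pmf" where
  "seq_pmf [] = return_pmf []"
| "seq_pmf (p # ps) = bind_pmf p (\<lambda>c. map_pmf ((#) c) (seq_pmf ps))"

lemma set_seq_pmf:
  assumes "\<And>p. p \<in> set ps \<Longrightarrow> set_pmf p \<subseteq> C" "cs \<in> set_pmf (seq_pmf ps)"
  shows "length cs = length ps" "set cs \<subseteq> C"
  using assms by (induction ps arbitrary: cs) fastforce+

text \<open>The bound \<open>exp x \<le> 1 + x + x^2\<close> on the unit interval, followed by
  \<open>1 + y \<le> exp y\<close> after taking means.\<close>

lemma mgf_le:
  fixes g :: "'c \<Rightarrow> real"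
  assumes g: "\<And>c. 0 \<le> g c" "\<And>c. g c \<le> 1" and l: "0 \<le> l" "l \<le> 1"
  shows "(\<integral>\<^sup>+c. ennreal (exp (l * g c)) \<partial>measure_pmf p) \<le> ennreal (exp (l * expect p g + l\<^sup>2))"
proof -
  have i: "integrable (measure_pmf p) g"
    using g by (intro integrable_bounded[where B=1]) auto
  have pt: "exp (l * g c) \<le> 1 + l * g c + l\<^sup>2" for c
  proof -
    have "0 \<le> l * g c" "l * g c \<le> l" using g[of c] l by (auto simp: mult_left_le)
    then have "exp (l * g c) \<le> 1 + l * g c + (l * g c)\<^sup>2" "(l * g c)\<^sup>2 \<le> l\<^sup>2"
      using l by (auto intro!: exp_bound power_mono)
    then show ?thesis by simp
  qed
  have "(\<integral>\<^sup>+c. ennreal (exp (l * g c)) \<partial>measure_pmf p) \<le> (\<integral>\<^sup>+c. ennreal (1 + l * g c + l\<^sup>2) \<partial>measure_pmf p)"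
    using pt by (intro nn_integral_mono ennreal_leI) auto
  also have "\<dots> = ennreal (expect p (\<lambda>c. 1 + l * g c + l\<^sup>2))"
    using i g l by (intro nn_integral_eq_integral) auto
  also have "expect p (\<lambda>c. 1 + l * g c + l\<^sup>2) = 1 + (l * expect p g + l\<^sup>2)"
    using i by simp
  also have "ennreal \<dots> \<le> ennreal (exp (l * expect p g + l\<^sup>2))"
    by (intro ennreal_leI exp_ge_add_one_self)
  finally show ?thesis .
qed

lemma seq_mgf_le:
  fixes g :: "'c \<Rightarrow> real"
  assumes g: "\<And>c. 0 \<le> g c" "\<And>c. g c \<le> 1" and l: "0 \<le> l" "l \<le> 1"
  shows "(\<integral>\<^sup>+cs. ennreal (exp (l * (\<Sum>c\<leftarrow>cs. g c))) \<partial>measure_pmf (seq_pmf ps))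
    \<le> ennreal (exp (l * (\<Sum>p\<leftarrow>ps. expect p g) + l\<^sup>2 * length ps))"
proof (induction ps)
  case (Cons p ps)
  have "(\<integral>\<^sup>+cs. ennreal (exp (l * (\<Sum>c\<leftarrow>cs. g c))) \<partial>measure_pmf (seq_pmf (p # ps)))
     = (\<integral>\<^sup>+c. (\<integral>\<^sup>+cs. ennreal (exp (l * g c)) * ennreal (exp (l * (\<Sum>c\<leftarrow>cs. g c))) \<partial>measure_pmf (seq_pmf ps)) \<partial>measure_pmf p)"
    by (simp add: distrib_left exp_add ennreal_mult)
  also have "\<dots> = (\<integral>\<^sup>+c. ennreal (exp (l * g c)) \<partial>measure_pmf p) *
      (\<integral>\<^sup>+cs. ennreal (exp (l * (\<Sum>c\<leftarrow>cs. g c))) \<partial>measure_pmf (seq_pmf ps))"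
    by (simp add: nn_integral_cmult nn_integral_multc)
  also have "\<dots> \<le> ennreal (exp (l * expect p g + l\<^sup>2)) * ennreal (exp (l * (\<Sum>p\<leftarrow>ps. expect p g) + l\<^sup>2 * length ps))"
    by (intro mult_mono Cons.IH mgf_le g l) auto
  also have "\<dots> = ennreal (exp (l * (\<Sum>p\<leftarrow>p # ps. expect p g) + l\<^sup>2 * length (p # ps)))"
    by (simp add: ennreal_mult[symmetric] exp_add[symmetric] algebra_simps)
  finally show ?case .
qed simp

text \<open>Chernoff's method with the parameter \<open>l\<close> left open. The summands need not
  be identically distributed, since a stream has two kinds of blocks.\<close>

lemma seq_tail_le:
  fixes g :: "'c \<Rightarrow> real" and l t :: real
  assumes g: "\<And>c. 0 \<le> g c" "\<And>c. g c \<le> 1" and l: "0 \<le> l" "l \<le> 1"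
  shows "measure_pmf.prob (seq_pmf ps) {cs. (\<Sum>p\<leftarrow>ps. expect p g) + t \<le> (\<Sum>c\<leftarrow>cs. g c)}
    \<le> exp (l\<^sup>2 * length ps - l * t)"
proof -
  let ?m = "(\<Sum>p\<leftarrow>ps. expect p g)"
  let ?B = "{cs. ?m + t \<le> (\<Sum>c\<leftarrow>cs. g c)}"
  have "emeasure (measure_pmf (seq_pmf ps)) ?B = (\<integral>\<^sup>+cs. indicator ?B cs \<partial>measure_pmf (seq_pmf ps))"
    by simp
  also have "\<dots> \<le> (\<integral>\<^sup>+cs. ennreal (exp (- l * (?m + t))) * ennreal (exp (l * (\<Sum>c\<leftarrow>cs. g c))) \<partial>measure_pmf (seq_pmf ps))"
    using l by (intro nn_integral_mono)
      (auto simp: indicator_def ennreal_mult[symmetric] exp_add[symmetric] simp flip: ennreal_1 intro!: ennreal_leI mult_left_mono)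
  also have "\<dots> = ennreal (exp (- l * (?m + t))) * (\<integral>\<^sup>+cs. ennreal (exp (l * (\<Sum>c\<leftarrow>cs. g c))) \<partial>measure_pmf (seq_pmf ps))"
    by (simp add: nn_integral_cmult)
  also have "\<dots> \<le> ennreal (exp (- l * (?m + t))) * ennreal (exp (l * ?m + l\<^sup>2 * length ps))"
    by (intro mult_left_mono seq_mgf_le g l) auto
  also have "\<dots> = ennreal (exp (l\<^sup>2 * length ps - l * t))"
    by (simp add: ennreal_mult[symmetric] exp_add[symmetric] algebra_simps)
  finally show ?thesis
    by (simp add: measure_pmf.emeasure_eq_measure)
qed

section \<open>Expected value of a planted constraint under a fixed assignment\<close>

lemma expect_planted:
  assumes "n \<ge> 4" "set_pmf Y \<subseteq> cube 4"
  shows "expect (planted n Y X) g = (\<Sum>j\<in>tuples n. expect Y (\<lambda>y. g (twist y X j, j, 1))) / card (tuples n)"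
proof -
  have fin: "finite (set_pmf Y)" using assms finite_cube finite_subset by blast
  show ?thesis
    unfolding planted_def using assms fin
    by (subst pmf_expectation_bind_pmf_of_set)
      (auto simp: tuples_nonempty finite_tuples sum_divide_distrib divide_inverse sum_distrib_left mult.commute)
qed

text \<open>The variables on which \<open>\<sigma>\<close> disagrees with the assignment that is \<open>-1\<close> exactly on \<open>X\<close>.\<close>

definition rel_set :: "nat \<Rightarrow> nat set \<Rightarrow> int list \<Rightarrow> nat set" where
  "rel_set n X \<sigma> = {i \<in> {..<n}. (i \<in> X) \<noteq> (\<sigma> ! i = -1)}"

text \<open>The planted sign and the sign under \<open>\<sigma>\<close> multiply to 1 exactly where
  the assignments agree, so only their disagreement set enters.\<close>

lemma constr_value_twist:
  assumes \<sigma>: "\<sigma> \<in> cube n" and j: "j \<in> tuples n" and y: "y \<in> cube 4"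
  shows "constr_value f \<sigma> (twist y X j, j, 1) = f (twist y (rel_set n X \<sigma>) j)"
proof -
  have "map2 (\<lambda>s i. s * \<sigma> ! i) (twist y X j) j = twist y (rel_set n X \<sigma>) j"
  proof (rule nth_equalityI)
    fix i assume "i < length (map2 (\<lambda>s i. s * \<sigma> ! i) (twist y X j) j)"
    then have i: "i < length j" "i < length y" by auto
    then have "j ! i \<in> set j" by simp
    then have "j ! i < n" using j by (auto simp: tuples_def)
    moreover from this have "\<sigma> ! (j ! i) = -1 \<or> \<sigma> ! (j ! i) = 1" using \<sigma> by (simp add: cube_iff_nth)
    ultimately show "map2 (\<lambda>s i. s * \<sigma> ! i) (twist y X j) j ! i = twist y (rel_set n X \<sigma>) j ! i"
      using i by (auto simp: nth_twist sign_def rel_set_def)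
  qed simp
  then show ?thesis by (simp add: constr_value_def)
qed

lemma constr_value_Th_bounds: "0 \<le> real (constr_value (Th t) \<sigma> c)" "real (constr_value (Th t) \<sigma> c) \<le> 1"
  by (auto simp: constr_value_def Th_def case_prod_beta)

lemma prime_support:
  "set_pmf D_0 \<subseteq> cube 4" "set_pmf D_Y_prime \<subseteq> cube 4" "set_pmf D_N_prime \<subseteq> cube 4"
  using star_properties by (auto simp: Delta_def)

lemma set_pmf_D_0: "y \<in> set_pmf D_0 \<Longrightarrow> y \<in> cube 4 \<and> ones y = 3"
  using ones_le[of y 4] unfolding set_pmf_iff pmf_star
  by (auto simp: less_Suc_eq_le[symmetric] less_Suc_eq numeral_eq_Suc split: if_splits)

lemma set_pmf_D_N_prime: "y \<in> set_pmf D_N_prime \<Longrightarrow> y \<in> cube 4 \<and> ones y = 2"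
  using ones_le[of y 4] unfolding set_pmf_iff pmf_star
  by (auto simp: less_Suc_eq_le[symmetric] less_Suc_eq numeral_eq_Suc split: if_splits)

lemma expect_Th_D_Y_prime: "expect D_Y_prime (\<lambda>y. real (Th 3 y)) = 2/3"
proof -
  have c: "x \<in> cube 4 \<Longrightarrow> pmf D_Y_prime x = [1/3, 0, 0, 1/6, 0] ! ones x" for x
    using ones_le[of x 4] card_layer_4 by (auto simp: pmf_star less_Suc_eq_le[symmetric] less_Suc_eq numeral_eq_Suc)
  have "expect D_Y_prime (\<lambda>y. real (Th 3 y)) = (\<Sum>x\<in>cube 4. [1/3, 0, 0, 1/6, 0] ! ones x * real (Th 3 x))"
    using prime_support by (subst expect_finite[OF finite_cube[of 4]]) (auto simp: c intro!: sum.cong)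
  also have "\<dots> = 2/3" unfolding sum_cube_4 by (simp add: Th_def)
  finally show ?thesis .
qed

definition plant :: "nat \<Rightarrow> nat set \<Rightarrow> int list" where
  "plant n X = map (sign X) [0..<n]"

lemma plant_cube: "plant n X \<in> cube n"
  by (auto simp: plant_def cube_def sign_def)

lemma expect_planted_plant:
  assumes n: "n \<ge> 4" and Y: "set_pmf Y \<subseteq> cube 4"
  shows "expect (planted n Y X) (\<lambda>c. real (constr_value f (plant n X) c)) = expect Y (\<lambda>y. real (f y))"
proof -
  have "expect Y (\<lambda>y. real (constr_value f (plant n X) (twist y X j, j, 1))) = expect Y (\<lambda>y. real (f y))"
    if j: "j \<in> tuples n" for j
  proof (intro integral_cong_AE)
    have "rel_set n X (plant n X) = {}" by (auto simp: rel_set_def plant_def sign_def)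
    moreover have "twist y {} j = y" if "y \<in> cube 4" for y
      using that j by (intro nth_equalityI) (auto simp: nth_twist sign_def cube_def tuples_def)
    ultimately show "AE y in measure_pmf Y. real (constr_value f (plant n X) (twist y X j, j, 1)) = real (f y)"
      using Y j by (auto simp: AE_measure_pmf_iff constr_value_twist[OF plant_cube])
  qed auto
  then show ?thesis
    using n tuples_nonempty finite_tuples by (subst expect_planted[OF n Y]) (simp add: card_gt_0_iff)
qed

lemma expect_planted_le:
  assumes n: "n \<ge> 4" and \<sigma>: "\<sigma> \<in> cube n"
    and Y: "\<And>y. y \<in> set_pmf Y \<Longrightarrow> y \<in> cube 4 \<and> (\<Sum>j\<in>tuples n. real (f (twist y (rel_set n X \<sigma>) j))) \<le> B"
  shows "expect (planted n Y X) (\<lambda>c. real (constr_value f \<sigma> c)) \<le> B / card (tuples n)"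
proof -
  have Y4: "set_pmf Y \<subseteq> cube 4" using Y by auto
  have fin: "finite (set_pmf Y)" using Y4 finite_cube finite_subset by blast
  have "(\<Sum>j\<in>tuples n. expect Y (\<lambda>y. real (constr_value f \<sigma> (twist y X j, j, 1))))
      = expect Y (\<lambda>y. \<Sum>j\<in>tuples n. real (constr_value f \<sigma> (twist y X j, j, 1)))"
    by (intro Bochner_Integration.integral_sum[symmetric] integrable_measure_pmf_finite fin)
  also have "\<dots> \<le> B"
    using Y by (intro measure_pmf.integral_le_const integrable_measure_pmf_finite fin)
      (auto simp: AE_measure_pmf_iff constr_value_twist[OF \<sigma>])
  finally show ?thesis
    by (subst expect_planted[OF n Y4]) (auto intro: divide_right_mono)
qed

lemma sum_sign:
  fixes \<phi> :: "int \<Rightarrow> real"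
  assumes "Z \<subseteq> {..<n}"
  shows "(\<Sum>i<n. \<phi> (sign Z i)) = (real n - card Z) * \<phi> 1 + card Z * \<phi> (-1)"
proof -
  have fZ: "finite Z" using assms finite_subset by blast
  have c: "real (card ({..<n} - Z)) = real n - card Z"
    using card_mono[of "{..<n}" Z] assms fZ by (simp add: card_Diff_subset of_nat_diff)
  have "(\<Sum>i<n. \<phi> (sign Z i)) = (\<Sum>i\<in>{..<n}. if i \<in> Z then \<phi> (-1) else \<phi> 1)"
    by (intro sum.cong) (auto simp: sign_def)
  also have "\<dots> = card Z * \<phi> (-1) + card ({..<n} - Z) * \<phi> 1"
    using assms by (simp add: sum.If_cases Int_absorb1 Diff_eq)
  finally show ?thesis using c by simp
qed

text \<open>Admitting repeated indices makes the four sums independent. The loss in expectation is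
  the factor \<open>n^4 / card (tuples n)\<close>, which tends to 1.\<close>

lemma sum_tuples_le:
  fixes g :: "nat list \<Rightarrow> real"
  assumes "\<And>j. 0 \<le> g j"
  shows "(\<Sum>j\<in>tuples n. g j) \<le> (\<Sum>a<n. \<Sum>b<n. \<Sum>c<n. \<Sum>d<n. g [a, b, c, d])"
proof -
  let ?q = "\<lambda>(a, b, c, d). [a, b, c, d]"
  have "tuples n \<subseteq> ?q ` ({..<n} \<times> {..<n} \<times> {..<n} \<times> {..<n})"
  proof
    fix j assume j: "j \<in> tuples n"
    then obtain a b c d where "j = [a, b, c, d]"
      by (auto simp: tuples_def length_Suc_conv numeral_eq_Suc)
    with j show "j \<in> ?q ` ({..<n} \<times> {..<n} \<times> {..<n} \<times> {..<n})"
      by (auto simp: tuples_def image_iff)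
  qed
  then have "(\<Sum>j\<in>tuples n. g j) \<le> (\<Sum>j\<in>?q ` ({..<n} \<times> {..<n} \<times> {..<n} \<times> {..<n}). g j)"
    using assms by (intro sum_mono2) auto
  also have "\<dots> = (\<Sum>a<n. \<Sum>b<n. \<Sum>c<n. \<Sum>d<n. g [a, b, c, d])"
    by (subst sum.reindex) (auto simp: inj_on_def sum.cartesian_product case_prod_beta)
  finally show ?thesis .
qed

text \<open>An index flips its literal in \<open>\<alpha>\<close> cases and keeps it in
  \<open>\<beta>\<close> cases. With three ones, either all of them are kept, or the -1 is flipped
  and exactly one of the ones is lost (3 ways). With two ones, four ones arise as
  \<open>\<alpha>\<^sup>2 * \<beta>\<^sup>2\<close>; exactly three arise by flipping just one -1, or
  both -1 and a single 1.\<close>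

lemma sum_Th_twist_le:
  fixes n :: nat and Z :: "nat set"
  assumes y: "y \<in> cube 4" and Z: "Z \<subseteq> {..<n}"
  defines "\<alpha> \<equiv> real (card Z)" and "\<beta> \<equiv> real n - real (card Z)"
  shows "ones y = 3 \<Longrightarrow> (\<Sum>j\<in>tuples n. real (Th 3 (twist y Z j))) \<le> \<beta>^3 * (\<alpha> + \<beta>) + 3 * \<alpha>\<^sup>2 * \<beta>\<^sup>2"
    and "ones y = 2 \<Longrightarrow> (\<Sum>j\<in>tuples n. real (Th 3 (twist y Z j))) \<le> 2 * \<alpha> * \<beta>^3 + \<alpha>\<^sup>2 * \<beta>\<^sup>2 + 2 * \<alpha>^3 * \<beta>"
proof -
  obtain y0 y1 y2 y3 where y4: "y = [y0, y1, y2, y3]"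
    using y by (auto simp: cube_def length_Suc_conv numeral_eq_Suc)
  define G where "G a b c d = real (Th 3 [y0 * a, y1 * b, y2 * c, y3 * d])" for a b c d
  define M where "M \<phi> = \<beta> * \<phi> 1 + \<alpha> * \<phi> (-1)" for \<phi> :: "int \<Rightarrow> real"
  have M: "(\<Sum>i<n. \<phi> (sign Z i)) = M \<phi>" for \<phi>
    unfolding M_def \<alpha>_def \<beta>_def by (rule sum_sign[OF Z])
  have "(\<Sum>j\<in>tuples n. real (Th 3 (twist y Z j))) \<le> (\<Sum>a<n. \<Sum>b<n. \<Sum>c<n. \<Sum>d<n. real (Th 3 (twist y Z [a, b, c, d])))"
    by (rule sum_tuples_le) simp
  also have "\<dots> = (\<Sum>a<n. \<Sum>b<n. \<Sum>c<n. \<Sum>d<n. G (sign Z a) (sign Z b) (sign Z c) (sign Z d))"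
    by (simp add: y4 twist_def G_def)
  also have "\<dots> = M (\<lambda>a. M (\<lambda>b. M (\<lambda>c. M (G a b c))))"
  proof -
    have "(\<Sum>d<n. G a b c (sign Z d)) = M (G a b c)" for a b c by (rule M)
    moreover have "(\<Sum>c<n. M (G a b (sign Z c))) = M (\<lambda>c. M (G a b c))" for a b
      by (rule M[of "\<lambda>c. M (G a b c)"])
    moreover have "(\<Sum>b<n. M (\<lambda>c. M (G a (sign Z b) c))) = M (\<lambda>b. M (\<lambda>c. M (G a b c)))" for a
      by (rule M[of "\<lambda>b. M (\<lambda>c. M (G a b c))"])
    ultimately show ?thesis
      using M[of "\<lambda>a. M (\<lambda>b. M (\<lambda>c. M (G a b c)))"] by simp
  qed
  finally have le: "(\<Sum>j\<in>tuples n. real (Th 3 (twist y Z j))) \<le> M (\<lambda>a. M (\<lambda>b. M (\<lambda>c. M (G a b c))))" .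
  have s: "y0 = -1 \<or> y0 = 1" "y1 = -1 \<or> y1 = 1" "y2 = -1 \<or> y2 = 1" "y3 = -1 \<or> y3 = 1"
    using y by (auto simp: y4 cube_def)
  show "(\<Sum>j\<in>tuples n. real (Th 3 (twist y Z j))) \<le> \<beta>^3 * (\<alpha> + \<beta>) + 3 * \<alpha>\<^sup>2 * \<beta>\<^sup>2" if "ones y = 3"
  proof -
    have "(y0, y1, y2, y3) \<in> {(-1, 1, 1, 1), (1, -1, 1, 1), (1, 1, -1, 1), (1, 1, 1, -1)}"
      using s that by (elim disjE) (simp_all add: y4)
    then have "M (\<lambda>a. M (\<lambda>b. M (\<lambda>c. M (G a b c)))) = \<beta>^3 * (\<alpha> + \<beta>) + 3 * \<alpha>\<^sup>2 * \<beta>\<^sup>2"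
      by (elim insertE emptyE Pair_inject; hypsubst; simp add: M_def G_def Th_def;
          simp add: algebra_simps power2_eq_square power3_eq_cube)
    then show ?thesis using le by simp
  qed
  show "(\<Sum>j\<in>tuples n. real (Th 3 (twist y Z j))) \<le> 2 * \<alpha> * \<beta>^3 + \<alpha>\<^sup>2 * \<beta>\<^sup>2 + 2 * \<alpha>^3 * \<beta>" if "ones y = 2"
  proof -
    have "(y0, y1, y2, y3) \<in> {(-1, -1, 1, 1), (-1, 1, -1, 1), (-1, 1, 1, -1), (1, -1, -1, 1), (1, -1, 1, -1), (1, 1, -1, -1)}"
      using s that by (elim disjE) (simp_all add: y4)
    then have "M (\<lambda>a. M (\<lambda>b. M (\<lambda>c. M (G a b c)))) = 2 * \<alpha> * \<beta>^3 + \<alpha>\<^sup>2 * \<beta>\<^sup>2 + 2 * \<alpha>^3 * \<beta>"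
      by (elim insertE emptyE Pair_inject; hypsubst; simp add: M_def G_def Th_def;
          simp add: algebra_simps power2_eq_square power3_eq_cube)
    then show ?thesis using le by simp
  qed
qed

text \<open>The maximum \<open>44/135\<close> is attained when a third of the assignment disagrees with the planted one;
  the difference of the two sides is \<open>(2\<alpha> - \<beta>)\<^sup>2\<close> times a positive form.\<close>

lemma no_polynomial_le:
  fixes \<alpha> \<beta> :: real
  assumes "0 \<le> \<alpha>" "0 \<le> \<beta>"
  shows "(\<beta>^3 * (\<alpha> + \<beta>) + 3 * \<alpha>\<^sup>2 * \<beta>\<^sup>2) + 4 * (2 * \<alpha> * \<beta>^3 + \<alpha>\<^sup>2 * \<beta>\<^sup>2 + 2 * \<alpha>^3 * \<beta>) \<le> 5 * (44/135) * (\<alpha> + \<beta>)^4"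
proof -
  have "0 \<le> (2 * \<alpha> - \<beta>)\<^sup>2 * (11 * \<alpha>\<^sup>2 + \<alpha> * \<beta> + 17 * \<beta>\<^sup>2) / 27"
    using assms by simp
  also have "\<dots> = 5 * (44/135) * (\<alpha> + \<beta>)^4 - ((\<beta>^3 * (\<alpha> + \<beta>) + 3 * \<alpha>\<^sup>2 * \<beta>\<^sup>2) + 4 * (2 * \<alpha> * \<beta>^3 + \<alpha>\<^sup>2 * \<beta>\<^sup>2 + 2 * \<alpha>^3 * \<beta>))"
    by (simp add: field_simps power2_eq_square power3_eq_cube power4_eq_xxxx)
  finally show ?thesis by simp
qed

text \<open>Both expectations involve the same disagreement set, so the polynomials are added, with
  the block lengths 1 and 4 as weights, before maximising; separate maxima would exceed
  \<open>44/135\<close>.\<close>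

lemma no_expectation_le:
  assumes n: "n \<ge> 4" and \<sigma>: "\<sigma> \<in> cube n"
  shows "expect (planted n D_0 X) (\<lambda>c. real (constr_value (Th 3) \<sigma> c)) +
      4 * expect (planted n D_N_prime X) (\<lambda>c. real (constr_value (Th 3) \<sigma> c))
    \<le> 5 * (44/135) * (real n^4 / card (tuples n))"
proof -
  define Z where "Z = rel_set n X \<sigma>"
  have Z: "Z \<subseteq> {..<n}" by (auto simp: Z_def rel_set_def)
  define \<alpha> \<beta> where "\<alpha> = real (card Z)" and "\<beta> = real n - real (card Z)"
  have "card Z \<le> n" using card_mono[OF _ Z] by simp
  then have ab: "0 \<le> \<alpha>" "0 \<le> \<beta>" "\<alpha> + \<beta> = n" by (auto simp: \<alpha>_def \<beta>_def)
  have 1: "expect (planted n D_0 X) (\<lambda>c. real (constr_value (Th 3) \<sigma> c))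
      \<le> (\<beta>^3 * (\<alpha> + \<beta>) + 3 * \<alpha>\<^sup>2 * \<beta>\<^sup>2) / card (tuples n)"
    using set_pmf_D_0 sum_Th_twist_le(1)[OF _ Z] unfolding \<alpha>_def \<beta>_def Z_def
    by (intro expect_planted_le[OF n \<sigma>]) blast
  have 2: "expect (planted n D_N_prime X) (\<lambda>c. real (constr_value (Th 3) \<sigma> c))
      \<le> (2 * \<alpha> * \<beta>^3 + \<alpha>\<^sup>2 * \<beta>\<^sup>2 + 2 * \<alpha>^3 * \<beta>) / card (tuples n)"
    using set_pmf_D_N_prime sum_Th_twist_le(2)[OF _ Z] unfolding \<alpha>_def \<beta>_def Z_def
    by (intro expect_planted_le[OF n \<sigma>]) blast
  have "(\<beta>^3 * (\<alpha> + \<beta>) + 3 * \<alpha>\<^sup>2 * \<beta>\<^sup>2) / card (tuples n) + 4 * ((2 * \<alpha> * \<beta>^3 + \<alpha>\<^sup>2 * \<beta>\<^sup>2 + 2 * \<alpha>^3 * \<beta>) / card (tuples n))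
     = ((\<beta>^3 * (\<alpha> + \<beta>) + 3 * \<alpha>\<^sup>2 * \<beta>\<^sup>2) + 4 * (2 * \<alpha> * \<beta>^3 + \<alpha>\<^sup>2 * \<beta>\<^sup>2 + 2 * \<alpha>^3 * \<beta>)) / card (tuples n)"
    by (simp add: add_divide_distrib)
  also have "\<dots> \<le> (5 * (44/135) * (\<alpha> + \<beta>)^4) / card (tuples n)"
    by (intro divide_right_mono no_polynomial_le ab) auto
  also have "\<dots> = 5 * (44/135) * (real n^4 / card (tuples n))" by (simp add: ab)
  finally show ?thesis using 1 2 by linarith
qed

section \<open>Streams of planted constraints\<close>

fun run :: "('s \<Rightarrow> 'c \<Rightarrow> 's pmf) \<Rightarrow> 's \<Rightarrow> 'c list \<Rightarrow> 's pmf" where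
  "run K s [] = return_pmf s"
| "run K s (c # cs) = bind_pmf (K s c) (\<lambda>t. run K t cs)"

lemma foldl_bind_eq_run:
  "foldl (\<lambda>M c. bind_pmf M (\<lambda>s. K s c)) M cs = bind_pmf M (\<lambda>s. run K s cs)"
  by (induction cs arbitrary: M) (simp_all add: bind_return_pmf' bind_assoc_pmf)

lemma run_append: "run K s (xs @ ys) = bind_pmf (run K s xs) (\<lambda>t. run K t ys)"
  by (induction xs arbitrary: s) (simp_all add: bind_return_pmf bind_assoc_pmf)

lemma memory_append: "memory A n (\<Psi> @ \<Phi>) = bind_pmf (memory A n \<Psi>) (\<lambda>s. run (alg_step A n) s \<Phi>)"
  unfolding memory_def foldl_bind_eq_run by (simp add: run_append bind_assoc_pmf)

text \<open>Given \<open>x\<close>, the constraints are independent of the memory, so they may all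
  be drawn before the algorithm runs; \<open>bind_commute_pmf\<close> performs the exchange.\<close>

lemma observe_iter_eq:
  "observe_iter P K m J = bind_pmf J (\<lambda>(x, s). bind_pmf (seq_pmf (replicate m (P x)))
     (\<lambda>cs. map_pmf (Pair x) (run K s cs)))"
proof (induction m arbitrary: J)
  case 0
  then show ?case by (simp add: bind_return_pmf bind_return_pmf' case_prod_beta)
next
  case (Suc m)
  have "bind_pmf (K s c) (\<lambda>t. bind_pmf (seq_pmf (replicate m (P x))) (\<lambda>cs. map_pmf (Pair x) (run K t cs)))
      = bind_pmf (seq_pmf (replicate m (P x))) (\<lambda>cs. bind_pmf (K s c) (\<lambda>t. map_pmf (Pair x) (run K t cs)))" for x s c
    by (rule bind_commute_pmf)
  then show ?case
    unfolding observe_iter.simps Suc observe_def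
    by (simp add: bind_assoc_pmf bind_map_pmf map_bind_pmf case_prod_beta)
qed

lemma seq_pmf_append:
  "seq_pmf (ps @ qs) = bind_pmf (seq_pmf ps) (\<lambda>a. map_pmf (append a) (seq_pmf qs))"
proof (induction ps)
  case Nil
  have "(@) ([] :: 'a list) = id" by auto
  then show ?case by (simp add: bind_return_pmf)
next
  case (Cons p ps)
  have "(@) (c # a) = (\<lambda>b. c # a @ b)" for c :: 'a and a by auto
  then show ?case
    by (simp add: Cons map_bind_pmf bind_map_pmf bind_assoc_pmf pmf.map_comp o_def)
qed

text \<open>Connects the two phases of the hybrid argument with a single run on a stream drawn in
  advance, which is what the correctness of an algorithm speaks about.\<close>

lemma observe_twice:
  "observe_iter P1 K m1 (observe_iter P0 K m0 (bind_pmf D (\<lambda>x. map_pmf (Pair x) I))) =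
   bind_pmf D (\<lambda>x. bind_pmf (seq_pmf (replicate m0 (P0 x) @ replicate m1 (P1 x)))
     (\<lambda>cs. map_pmf (Pair x) (foldl (\<lambda>M c. bind_pmf M (\<lambda>s. K s c)) I cs)))"
proof -
  have 1: "bind_pmf I (\<lambda>s. bind_pmf (seq_pmf ps) (\<lambda>a. bind_pmf (run K s a) (\<lambda>t. bind_pmf (seq_pmf qs) (\<lambda>b. h t b))))
    = bind_pmf (seq_pmf ps) (\<lambda>a. bind_pmf (seq_pmf qs) (\<lambda>b. bind_pmf I (\<lambda>s. bind_pmf (run K s a) (\<lambda>t. h t b))))"
    for ps qs and h :: "'b \<Rightarrow> 'c list \<Rightarrow> 'd pmf"
  proof -
    have "bind_pmf I (\<lambda>s. bind_pmf (seq_pmf ps) (\<lambda>a. bind_pmf (run K s a) (\<lambda>t. bind_pmf (seq_pmf qs) (\<lambda>b. h t b))))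
       = bind_pmf I (\<lambda>s. bind_pmf (seq_pmf ps) (\<lambda>a. bind_pmf (seq_pmf qs) (\<lambda>b. bind_pmf (run K s a) (\<lambda>t. h t b))))"
      by (subst bind_commute_pmf) rule
    also have "\<dots> = bind_pmf (seq_pmf ps) (\<lambda>a. bind_pmf I (\<lambda>s. bind_pmf (seq_pmf qs) (\<lambda>b. bind_pmf (run K s a) (\<lambda>t. h t b))))"
      by (rule bind_commute_pmf)
    also have "\<dots> = bind_pmf (seq_pmf ps) (\<lambda>a. bind_pmf (seq_pmf qs) (\<lambda>b. bind_pmf I (\<lambda>s. bind_pmf (run K s a) (\<lambda>t. h t b))))"
      by (subst bind_commute_pmf) rule
    finally show ?thesis .
  qed
  show ?thesis
    unfolding observe_iter_eq seq_pmf_append foldl_bind_eq_run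
    by (simp add: bind_assoc_pmf bind_map_pmf map_bind_pmf run_append 1)
qed

lemma map_fst_observe_iter: "map_pmf fst (observe_iter P K m J) = map_pmf fst J"
  by (induction m arbitrary: J) (simp_all add: map_fst_observe)

lemma set_observe_iter:
  assumes P: "\<And>x. x \<in> A \<Longrightarrow> set_pmf (P x) \<subseteq> C"
    and R: "\<And>i s c t. R i s \<Longrightarrow> c \<in> C \<Longrightarrow> t \<in> set_pmf (K s c) \<Longrightarrow> R (Suc i) t"
    and J: "set_pmf J \<subseteq> A \<times> {s. R i s}"
  shows "set_pmf (observe_iter P K m J) \<subseteq> A \<times> {s. R (i + m) s}"
  using J
proof (induction m arbitrary: J i)
  case (Suc m)
  have "set_pmf (observe P K J) \<subseteq> A \<times> {s. R (Suc i) s}"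
    using Suc.prems(1) R P unfolding set_pmf_observe by fastforce
  then show ?case using Suc.IH[of "observe P K J" "Suc i"] by simp
qed simp

text \<open>The quantity \<open>q\<close> does not depend on \<open>Y\<close>, so the algorithm cannot tell any two unbiased
  distributions apart.\<close>

lemma observe_iter_close:
  fixes J :: "(nat set \<times> 's) pmf"
  assumes n: "n \<ge> 6" and Y: "set_pmf Y \<subseteq> cube 4"
    and unbiased: "\<And>i. i < 4 \<Longrightarrow> expect Y (\<lambda>y. real_of_int (y ! i)) = 0"
    and S: "finite \<Sigma>" "card \<Sigma> \<le> 2^r" "1 \<le> r" "2 * r \<le> n"
    and R: "\<And>i s c t. R i s \<Longrightarrow> c \<in> unit_constrs n \<Longrightarrow> t \<in> set_pmf (K s c) \<Longrightarrow> R (Suc i) t"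
    and R\<Sigma>: "\<And>i s. R i s \<Longrightarrow> i \<le> N \<Longrightarrow> s \<in> \<Sigma>"
    and J: "set_pmf J \<subseteq> Pow {..<n} \<times> {s. R i s}" "map_pmf fst J = pmf_of_set (Pow {..<n})" "i + m \<le> N"
    and h: "\<And>s. 0 \<le> h s" "\<And>s. h s \<le> 1" and l: "0 < l" "l \<le> 1/2"
  defines "q \<equiv> expect J (\<lambda>z. noise_accept (unit_constrs n) K h m (snd z))"
  shows "\<bar>expect (observe_iter (planted n Y) K m J) (\<lambda>z. h (snd z)) - q\<bar>
    \<le> l + real m * (2^23 * (real r / real n)\<^sup>2) / (4 * l)"
proof -
  let ?\<eta> = "real m * (2^23 * (real r / real n)\<^sup>2) / (4 * l)"
  have fin: "finite (Pow {..<n})" "finite \<Sigma>" "finite (unit_constrs n)" "unit_constrs n \<noteq> {}"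
    using S n finite_unit_constrs unit_constrs_nonempty by auto
  have P: "set_pmf (planted n Y X) \<subseteq> unit_constrs n" for X
    using set_pmf_planted[OF _ Y] n by simp
  have chi: "chi2 (Pow {..<n}) \<Sigma> (unit_constrs n) (planted n Y) J' \<le> 2^23 * (real r / real n)\<^sup>2"
    if "set_pmf J' \<subseteq> Pow {..<n} \<times> \<Sigma>" "map_pmf fst J' = pmf_of_set (Pow {..<n})" for J' :: "(nat set \<times> 's) pmf"
    using chi2_planted_le[OF n Y unbiased S that] by simp
  have up: "expect (observe_iter (planted n Y) K m J) (\<lambda>z. g (snd z))
      \<le> expect J (\<lambda>z. noise_accept (unit_constrs n) K g m (snd z)) + (l + ?\<eta>)"
    if g: "\<And>s. 0 \<le> g s" "\<And>s. g s \<le> 1" for g :: "'s \<Rightarrow> real"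
  proof -
    note na = noise_accept_bounds[of g "unit_constrs n" K m, OF g]
    have i: "integrable (measure_pmf p) (\<lambda>z. g (snd z))" "integrable (measure_pmf p) (\<lambda>z. potential l (g (snd z)))"
      "integrable (measure_pmf p) (\<lambda>z. noise_accept (unit_constrs n) K g m (snd z))"
      "integrable (measure_pmf p) (\<lambda>z. potential l (noise_accept (unit_constrs n) K g m (snd z)))"
      for p :: "(nat set \<times> 's) pmf"
      using g na potential_bounds(3)[OF g l] potential_bounds(3)[OF na l]
      by (auto intro!: integrable_bounded[where B=1])
    have "expect (observe_iter (planted n Y) K m J) (\<lambda>z. g (snd z)) - l
        = expect (observe_iter (planted n Y) K m J) (\<lambda>z. g (snd z) - l)"
      using i by simp
    also have "\<dots> \<le> expect (observe_iter (planted n Y) K m J) (\<lambda>z. potential l (g (snd z)))"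
      using i potential_bounds(1)[OF g l] by (intro integral_mono) auto
    also have "\<dots> \<le> expect J (\<lambda>z. potential l (noise_accept (unit_constrs n) K g m (snd z))) + ?\<eta>"
      by (rule observe_iter_potential_le[OF g l fin P chi R R\<Sigma> J])
    also have "expect J (\<lambda>z. potential l (noise_accept (unit_constrs n) K g m (snd z)))
        \<le> expect J (\<lambda>z. noise_accept (unit_constrs n) K g m (snd z))"
      using i potential_bounds(2)[OF na l] by (intro integral_mono) auto
    finally show ?thesis by simp
  qed
  have ih: "integrable (measure_pmf p) (\<lambda>z. h (snd z))"
      "integrable (measure_pmf p) (\<lambda>z. noise_accept (unit_constrs n) K h m (snd z))"
    for p :: "(nat set \<times> 's) pmf"
    using h noise_accept_bounds[of h "unit_constrs n" K m, OF h] by (auto intro!: integrable_bounded[where B=1])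
  have "expect (observe_iter (planted n Y) K m J) (\<lambda>z. h (snd z)) \<le> q + (l + ?\<eta>)"
    unfolding q_def by (rule up[OF h])
  \<comment> \<open>The upper bound applied to the rejection test \<open>1 - h\<close> gives the
    lower bound for \<open>h\<close>.\<close>
  moreover have "1 - expect (observe_iter (planted n Y) K m J) (\<lambda>z. h (snd z)) \<le> (1 - q) + (l + ?\<eta>)"
    using up[of "\<lambda>s. 1 - h s"] h ih by (simp add: noise_accept_compl q_def)
  ultimately show ?thesis by linarith
qed

section \<open>Concentration of the CSP value of planted streams\<close>

lemma unit_constrs_instance:
  assumes "set \<Psi> \<subseteq> unit_constrs n" "\<Psi> \<noteq> []"
  shows "csp_instance 4 n \<Psi>" "total_weight \<Psi> = length \<Psi>"
proof -
  have w: "weight c = 1" if "c \<in> set \<Psi>" for c using that assms by (auto simp: unit_constrs_def weight_def)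
  have "map weight \<Psi> = map (\<lambda>_. 1) \<Psi>" using w by simp
  then show "total_weight \<Psi> = length \<Psi>" by (simp add: total_weight_def map_replicate_const sum_list_replicate)
  with assms show "csp_instance 4 n \<Psi>"
    by (fastforce simp: csp_instance_def valid_constr_def unit_constrs_def tuples_def)
qed

lemma unit_constrs_poly_size:
  assumes "set \<Psi> \<subseteq> unit_constrs n" "length \<Psi> \<le> n^2" "n \<ge> 1"
  shows "poly_size 2 n \<Psi>"
  unfolding poly_size_def
proof (intro conjI ballI)
  fix c assume "c \<in> set \<Psi>"
  then have "weight c = real 1" using assms by (auto simp: unit_constrs_def weight_def)
  moreover have "1 \<in> {..n^2}" using assms by simp
  ultimately show "weight c \<in> real ` {..n^2}" by blast
qed (use assms in simp)

lemma assignment_value_unit: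
  assumes "set \<Psi> \<subseteq> unit_constrs n" "\<Psi> \<noteq> []"
  shows "assignment_value f \<Psi> \<sigma> = (\<Sum>c\<leftarrow>\<Psi>. real (constr_value f \<sigma> c)) / length \<Psi>"
proof -
  have "weight c = 1" if "c \<in> set \<Psi>" for c using that assms by (auto simp: unit_constrs_def weight_def)
  then have "map (\<lambda>c. weight c * real (constr_value f \<sigma> c)) \<Psi> = map (\<lambda>c. real (constr_value f \<sigma> c)) \<Psi>" by simp
  then have "sum_list (map (\<lambda>c. weight c * real (constr_value f \<sigma> c)) \<Psi>) / real (length \<Psi>)
      = (\<Sum>c\<leftarrow>\<Psi>. real (constr_value f \<sigma> c)) / real (length \<Psi>)" by (simp only:)
  then show ?thesis unfolding assignment_value_def unit_constrs_instance(2)[OF assms] .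
qed

lemma csp_val_ge: "\<sigma> \<in> cube n \<Longrightarrow> assignment_value f \<Psi> \<sigma> \<le> csp_val f n \<Psi>"
  unfolding csp_val_def using finite_cube by (intro Max_ge) auto

lemma csp_val_attained: "\<exists>\<sigma>\<in>cube n. csp_val f n \<Psi> = assignment_value f \<Psi> \<sigma>"
proof -
  have "csp_val f n \<Psi> \<in> assignment_value f \<Psi> ` cube n"
    unfolding csp_val_def using finite_cube card_cube[of n] by (intro Max_in) auto
  then show ?thesis by auto
qed

text \<open>With \<open>l = \<delta>/4\<close> and \<open>t = \<delta>/2 * m\<close> the exponent in
  \<open>seq_tail_le\<close> is \<open>- \<delta>^2 * m / 16\<close>. The target
  \<open>- 2 * n\<close> leaves room for a union bound over \<open>2^n\<close> assignments.\<close>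

lemma tail_exponent:
  fixes \<delta> :: real
  assumes "0 < \<delta>" "32 * real n \<le> \<delta>\<^sup>2 * real m"
  shows "exp ((\<delta>/4)\<^sup>2 * real m - \<delta>/4 * (\<delta>/2 * real m)) \<le> exp (- 2 * real n)"
  using assms by (simp add: power2_eq_square field_simps)

text \<open>The tail bound is for upper deviations, so it is applied to the constraints that the
  hidden assignment violates: probability 0 in the first block and \<open>1/3\<close> in the second,
  hence \<open>4/15\<close> on average.\<close>

lemma yes_value:
  assumes n: "n \<ge> 4" and m: "m = 5 * k" "k > 0" and \<delta>: "0 < \<delta>" "\<delta> \<le> 1" "32 * real n \<le> \<delta>\<^sup>2 * real m"
  shows "measure_pmf.prob (seq_pmf (replicate k (planted n D_0 X) @ replicate (4*k) (planted n D_Y_prime X)))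
      {\<Psi>. csp_val (Th 3) n \<Psi> < 11/15 - \<delta>} \<le> exp (- 2 * real n)"
proof -
  let ?ps = "replicate k (planted n D_0 X) @ replicate (4*k) (planted n D_Y_prime X)"
  let ?g = "\<lambda>c. 1 - real (constr_value (Th 3) (plant n X) c)"
  have i: "integrable (measure_pmf p) (\<lambda>c. real (constr_value (Th 3) (plant n X) c))" for p
    using constr_value_Th_bounds by (intro integrable_bounded[where B=1]) auto
  have "expect D_0 (\<lambda>y. real (Th 3 y)) = expect D_0 (\<lambda>y. 1)"
    using set_pmf_D_0 by (intro integral_cong_AE) (auto simp: AE_measure_pmf_iff Th_def)
  then have e0: "expect (planted n D_0 X) ?g = 0"
    using i expect_planted_plant[OF n prime_support(1)] by simp
  have e1: "expect (planted n D_Y_prime X) ?g = 1/3"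
    using i expect_planted_plant[OF n prime_support(2)] expect_Th_D_Y_prime by simp
  have mean: "(\<Sum>p\<leftarrow>?ps. expect p ?g) = 4/15 * real m"
    by (simp add: e0 e1 sum_list_replicate m)
  have "{\<Psi>. csp_val (Th 3) n \<Psi> < 11/15 - \<delta>} \<inter> set_pmf (seq_pmf ?ps)
      \<subseteq> {\<Psi>. (\<Sum>p\<leftarrow>?ps. expect p ?g) + \<delta>/2 * real m \<le> (\<Sum>c\<leftarrow>\<Psi>. ?g c)}"
  proof (safe)
    fix \<Psi> assume v: "csp_val (Th 3) n \<Psi> < 11/15 - \<delta>" and s: "\<Psi> \<in> set_pmf (seq_pmf ?ps)"
    have p: "set_pmf p \<subseteq> unit_constrs n" if "p \<in> set ?ps" for p
      using that set_pmf_planted[OF n] prime_support by (auto split: if_splits)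
    have len: "length \<Psi> = m" and U: "set \<Psi> \<subseteq> unit_constrs n" using set_seq_pmf[OF p s] m by auto
    have ne: "\<Psi> \<noteq> []" using len m by auto
    have "(\<Sum>c\<leftarrow>\<Psi>. real (constr_value (Th 3) (plant n X) c)) / m < 11/15 - \<delta>"
      using v csp_val_ge[OF plant_cube[of n X], of "Th 3" \<Psi>] assignment_value_unit[OF U ne] len by simp
    then have "(\<Sum>c\<leftarrow>\<Psi>. real (constr_value (Th 3) (plant n X) c)) < (11/15 - \<delta>) * m"
      using m by (simp add: divide_less_eq)
    moreover have "(\<Sum>c\<leftarrow>\<Psi>. ?g c) = m - (\<Sum>c\<leftarrow>\<Psi>. real (constr_value (Th 3) (plant n X) c))"
      using len by (simp add: sum_list_subtractf sum_list_triv)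
    moreover have "0 \<le> \<delta> * real m" using \<delta> by simp
    ultimately show "(\<Sum>p\<leftarrow>?ps. expect p ?g) + \<delta>/2 * real m \<le> (\<Sum>c\<leftarrow>\<Psi>. ?g c)"
      unfolding mean by (simp add: algebra_simps)
  qed
  then have "measure_pmf.prob (seq_pmf ?ps) {\<Psi>. csp_val (Th 3) n \<Psi> < 11/15 - \<delta>}
     \<le> measure_pmf.prob (seq_pmf ?ps) {\<Psi>. (\<Sum>p\<leftarrow>?ps. expect p ?g) + \<delta>/2 * real m \<le> (\<Sum>c\<leftarrow>\<Psi>. ?g c)}"
    by (intro measure_pmf.finite_measure_mono_AE) (auto simp: AE_measure_pmf_iff)
  also have "\<dots> \<le> exp ((\<delta>/4)\<^sup>2 * length ?ps - \<delta>/4 * (\<delta>/2 * real m))"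
    using constr_value_Th_bounds \<delta> by (intro seq_tail_le) auto
  also have "\<dots> \<le> exp (- 2 * real n)"
    using tail_exponent[OF \<delta>(1,3)] m by simp
  finally show ?thesis .
qed

text \<open>Half of \<open>\<delta>\<close> absorbs the correction for distinct indices, the other
  half the random deviation. The \<open>2^n \<le> exp n\<close> assignments each fail with
  probability at most \<open>exp (- 2 * n)\<close>.\<close>

lemma no_value:
  assumes n: "n \<ge> 4" and m: "m = 5 * k" "k > 0" and \<delta>: "0 < \<delta>" "\<delta> \<le> 1" "32 * real n \<le> \<delta>\<^sup>2 * real m"
    and large: "44/135 * (real n^4 / card (tuples n)) \<le> 44/135 + \<delta>/2"
  shows "measure_pmf.prob (seq_pmf (replicate k (planted n D_0 X) @ replicate (4*k) (planted n D_N_prime X)))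
      {\<Psi>. 44/135 + \<delta> < csp_val (Th 3) n \<Psi>} \<le> exp (- real n)"
proof -
  let ?ps = "replicate k (planted n D_0 X) @ replicate (4*k) (planted n D_N_prime X)"
  let ?g = "\<lambda>\<sigma> c. real (constr_value (Th 3) \<sigma> c)"
  let ?B = "\<lambda>\<sigma>. {\<Psi>. (\<Sum>p\<leftarrow>?ps. expect p (?g \<sigma>)) + \<delta>/2 * real m \<le> (\<Sum>c\<leftarrow>\<Psi>. ?g \<sigma> c)}"
  have mean: "(\<Sum>p\<leftarrow>?ps. expect p (?g \<sigma>)) \<le> (44/135 + \<delta>/2) * real m" if "\<sigma> \<in> cube n" for \<sigma>
  proof -
    have "(\<Sum>p\<leftarrow>?ps. expect p (?g \<sigma>)) = real k * (expect (planted n D_0 X) (?g \<sigma>) + 4 * expect (planted n D_N_prime X) (?g \<sigma>))"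
      by (simp add: sum_list_replicate algebra_simps)
    also have "\<dots> \<le> real k * (5 * (44/135 + \<delta>/2))"
      using no_expectation_le[OF n that, of X] large by (intro mult_left_mono) auto
    also have "\<dots> = (44/135 + \<delta>/2) * real m" by (simp add: m algebra_simps)
    finally show ?thesis .
  qed
  have "{\<Psi>. 44/135 + \<delta> < csp_val (Th 3) n \<Psi>} \<inter> set_pmf (seq_pmf ?ps) \<subseteq> (\<Union>\<sigma>\<in>cube n. ?B \<sigma>)"
  proof (safe)
    fix \<Psi> assume v: "44/135 + \<delta> < csp_val (Th 3) n \<Psi>" and s: "\<Psi> \<in> set_pmf (seq_pmf ?ps)"
    have p: "set_pmf p \<subseteq> unit_constrs n" if "p \<in> set ?ps" for p
      using that set_pmf_planted[OF n] prime_support by (auto split: if_splits)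
    have len: "length \<Psi> = m" and U: "set \<Psi> \<subseteq> unit_constrs n" using set_seq_pmf[OF p s] m by auto
    have ne: "\<Psi> \<noteq> []" using len m by auto
    obtain \<sigma> where \<sigma>: "\<sigma> \<in> cube n" "csp_val (Th 3) n \<Psi> = assignment_value (Th 3) \<Psi> \<sigma>"
      using csp_val_attained by blast
    then have "44/135 + \<delta> < (\<Sum>c\<leftarrow>\<Psi>. ?g \<sigma> c) / m"
      using v assignment_value_unit[OF U ne] len by simp
    then have "(44/135 + \<delta>) * m < (\<Sum>c\<leftarrow>\<Psi>. ?g \<sigma> c)" using m by (simp add: less_divide_eq)
    then have "\<Psi> \<in> ?B \<sigma>" using mean[OF \<sigma>(1)] by (simp add: algebra_simps)
    then show "\<Psi> \<in> (\<Union>\<sigma>\<in>cube n. ?B \<sigma>)" using \<sigma> by blast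
  qed
  then have "measure_pmf.prob (seq_pmf ?ps) {\<Psi>. 44/135 + \<delta> < csp_val (Th 3) n \<Psi>}
     \<le> measure_pmf.prob (seq_pmf ?ps) (\<Union>\<sigma>\<in>cube n. ?B \<sigma>)"
    by (intro measure_pmf.finite_measure_mono_AE) (auto simp: AE_measure_pmf_iff)
  also have "\<dots> \<le> (\<Sum>\<sigma>\<in>cube n. measure_pmf.prob (seq_pmf ?ps) (?B \<sigma>))"
    using finite_cube by (intro measure_pmf.finite_measure_subadditive_finite) auto
  also have "\<dots> \<le> (\<Sum>\<sigma>\<in>cube n. exp (- 2 * real n))"
  proof (rule sum_mono)
    fix \<sigma> assume "\<sigma> \<in> cube n"
    have "measure_pmf.prob (seq_pmf ?ps) (?B \<sigma>) \<le> exp ((\<delta>/4)\<^sup>2 * length ?ps - \<delta>/4 * (\<delta>/2 * real m))"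
      using constr_value_Th_bounds \<delta> by (intro seq_tail_le) auto
    also have "\<dots> \<le> exp (- 2 * real n)" using tail_exponent[OF \<delta>(1,3)] m by simp
    finally show "measure_pmf.prob (seq_pmf ?ps) (?B \<sigma>) \<le> exp (- 2 * real n)" .
  qed
  also have "\<dots> = 2^n * exp (- 2 * real n)" by (simp add: card_cube)
  also have "\<dots> \<le> exp (real n) * exp (- 2 * real n)"
  proof -
    have "(2::real)^n \<le> exp 1^n" using exp_ge_add_one_self[of 1] by (intro power_mono) auto
    then show ?thesis by (intro mult_right_mono) (auto simp: exp_of_nat_mult[symmetric])
  qed
  also have "\<dots> = exp (- real n)" by (simp add: exp_add[symmetric])
  finally show ?thesis .
qed

section \<open>An approximation algorithm as a distinguisher by thresholding its output\<close>

lemma prob_bind_eq: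
  "measure_pmf.prob (bind_pmf p K) E = expect p (\<lambda>x. measure_pmf.prob (K x) E)"
proof -
  have "expect (bind_pmf p K) (indicator E) = expect p (\<lambda>x. expect (K x) (indicator E))"
    by (intro expect_bind[where B=1]) (auto simp: indicator_def)
  then show ?thesis by simp
qed

lemma prob_accept_ge:
  assumes approx: "approximates A (4/9 + \<epsilon>) 4 (Th 3)" and \<epsilon>: "\<epsilon> > 0"
    and inst: "\<And>\<Psi>. \<Psi> \<in> set_pmf P \<Longrightarrow> csp_instance 4 n \<Psi>"
    and bad: "measure_pmf.prob P {\<Psi>. csp_val (Th 3) n \<Psi> < w} \<le> \<gamma>"
  shows "2/3 - \<gamma> \<le> expect P (\<lambda>\<Psi>. measure_pmf.prob (alg_output A n \<Psi>) {v. (4/9 + \<epsilon>) * w \<le> v})"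
proof -
  let ?b = "{\<Psi>. csp_val (Th 3) n \<Psi> < w}"
  have "2/3 - indicator ?b \<Psi> \<le> measure_pmf.prob (alg_output A n \<Psi>) {v. (4/9 + \<epsilon>) * w \<le> v}"
    if "\<Psi> \<in> set_pmf P" for \<Psi>
  proof (cases "\<Psi> \<in> ?b")
    case True
    have "0 \<le> measure_pmf.prob (alg_output A n \<Psi>) {v. (4/9 + \<epsilon>) * w \<le> v}" by simp
    moreover have "indicator ?b \<Psi> = (1::real)" using True by simp
    ultimately show ?thesis by linarith
  next
    case False
    then have "w \<le> csp_val (Th 3) n \<Psi>" by simp
    then have "(4/9 + \<epsilon>) * w \<le> (4/9 + \<epsilon>) * csp_val (Th 3) n \<Psi>" using \<epsilon> by (intro mult_left_mono) auto
    then have "measure_pmf.prob (alg_output A n \<Psi>) {v. (4/9 + \<epsilon>) * csp_val (Th 3) n \<Psi> \<le> v \<and> v \<le> csp_val (Th 3) n \<Psi>}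
        \<le> measure_pmf.prob (alg_output A n \<Psi>) {v. (4/9 + \<epsilon>) * w \<le> v}"
      by (intro measure_pmf.finite_measure_mono) auto
    moreover have "2/3 \<le> measure_pmf.prob (alg_output A n \<Psi>) {v. (4/9 + \<epsilon>) * csp_val (Th 3) n \<Psi> \<le> v \<and> v \<le> csp_val (Th 3) n \<Psi>}"
      using approx inst[OF that] unfolding approximates_def by blast
    moreover have "indicator ?b \<Psi> = (0::real)" using False by simp
    ultimately show ?thesis by linarith
  qed
  then have "expect P (\<lambda>\<Psi>. 2/3 - indicator ?b \<Psi>) \<le> expect P (\<lambda>\<Psi>. measure_pmf.prob (alg_output A n \<Psi>) {v. (4/9 + \<epsilon>) * w \<le> v})"
    by (intro integral_mono_AE integrable_bounded[where B=1]) (auto simp: AE_measure_pmf_iff indicator_def)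
  moreover have "expect P (\<lambda>\<Psi>. 2/3 - indicator ?b \<Psi>) = 2/3 - measure_pmf.prob P ?b"
    by (subst Bochner_Integration.integral_diff) (auto intro: integrable_bounded[where B=1])
  ultimately show ?thesis using bad by simp
qed

lemma prob_accept_le:
  assumes approx: "approximates A a 4 (Th 3)"
    and inst: "\<And>\<Psi>. \<Psi> \<in> set_pmf P \<Longrightarrow> csp_instance 4 n \<Psi>"
    and bad: "measure_pmf.prob P {\<Psi>. w < csp_val (Th 3) n \<Psi>} \<le> \<gamma>" and \<theta>: "w < \<theta>"
  shows "expect P (\<lambda>\<Psi>. measure_pmf.prob (alg_output A n \<Psi>) {v. \<theta> \<le> v}) \<le> 1/3 + \<gamma>"
proof -
  let ?b = "{\<Psi>. w < csp_val (Th 3) n \<Psi>}"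
  have "measure_pmf.prob (alg_output A n \<Psi>) {v. \<theta> \<le> v} \<le> 1/3 + indicator ?b \<Psi>"
    if "\<Psi> \<in> set_pmf P" for \<Psi>
  proof (cases "\<Psi> \<in> ?b")
    case True
    have "measure_pmf.prob (alg_output A n \<Psi>) {v. \<theta> \<le> v} \<le> 1" by simp
    moreover have "indicator ?b \<Psi> = (1::real)" using True by simp
    ultimately show ?thesis by linarith
  next
    case False
    let ?ok = "{v. a * csp_val (Th 3) n \<Psi> \<le> v \<and> v \<le> csp_val (Th 3) n \<Psi>}"
    have "measure_pmf.prob (alg_output A n \<Psi>) {v. \<theta> \<le> v} \<le> measure_pmf.prob (alg_output A n \<Psi>) (UNIV - ?ok)"
      using False \<theta> by (intro measure_pmf.finite_measure_mono) auto
    also have "\<dots> = 1 - measure_pmf.prob (alg_output A n \<Psi>) ?ok"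
      using measure_pmf.prob_compl[of ?ok "alg_output A n \<Psi>"] by simp
    also have "\<dots> \<le> 1/3" using approx inst[OF that] unfolding approximates_def by fastforce
    also have "1/3 = (1/3 + indicator ?b \<Psi> :: real)" using False by simp
    finally show ?thesis .
  qed
  then have "expect P (\<lambda>\<Psi>. measure_pmf.prob (alg_output A n \<Psi>) {v. \<theta> \<le> v}) \<le> expect P (\<lambda>\<Psi>. 1/3 + indicator ?b \<Psi>)"
  proof (intro integral_mono_AE)
    show "integrable (measure_pmf P) (\<lambda>\<Psi>. measure_pmf.prob (alg_output A n \<Psi>) {v. \<theta> \<le> v})"
      by (intro integrable_bounded[where B=1]) simp
    show "integrable (measure_pmf P) (\<lambda>\<Psi>. 1/3 + indicator ?b \<Psi> :: real)"
      by (intro integrable_bounded[where B=2]) (simp add: indicator_def)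
  qed (simp add: AE_measure_pmf_iff)
  moreover have "expect P (\<lambda>\<Psi>. 1/3 + indicator ?b \<Psi>) = 1/3 + measure_pmf.prob P ?b"
    by (subst Bochner_Integration.integral_add) (auto intro: integrable_bounded[where B=1])
  ultimately show ?thesis using bad by simp
qed

section \<open>The space lower bound\<close>

text \<open>Memory strings of all lengths up to \<open>b\<close> count, which is why
  \<open>r\<close> becomes \<open>b + 1\<close>.\<close>

lemma card_bool_lists_le: "finite {x :: bool list. length x \<le> b}" "card {x :: bool list. length x \<le> b} \<le> 2^(b + 1)"
proof -
  have "card {x :: bool list. length x \<le> b} = (\<Sum>i\<le>b. 2^i)"
    using card_lists_length_le[of "UNIV :: bool set" b] by simp
  also have "\<dots> \<le> 2^(b + 1)"
    by (induction b) auto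
  finally show "card {x :: bool list. length x \<le> b} \<le> 2^(b + 1)" .
  show "finite {x :: bool list. length x \<le> b}"
    using finite_lists_length_le[of "UNIV :: bool set" b] by simp
qed

lemma tuples_ratio_tendsto: "(\<lambda>n. real n^4 / card (tuples n)) \<longlonglongrightarrow> 1"
proof -
  have "(\<lambda>n. real n^4 / (real n * (real n - 1) * (real n - 2) * (real n - 3))) \<longlonglongrightarrow> 1"
    by real_asymp
  moreover have "\<forall>\<^sub>F n in sequentially. real n^4 / (real n * (real n - 1) * (real n - 2) * (real n - 3)) = real n^4 / card (tuples n)"
    using eventually_ge_at_top[of 4]
  proof eventually_elim
    case (elim n)
    then have "real (card (tuples n)) = real n * (real n - 1) * (real n - 2) * (real n - 3)"
      using card_tuples[of "n - 4"] by (simp add: of_nat_diff)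
    then show ?case by simp
  qed
  ultimately show ?thesis by (rule Lim_transform_eventually)
qed

lemma streaming_contradiction:
  fixes n k r b :: nat and \<delta> \<epsilon> :: real
  assumes approx: "approximates A (4/9 + \<epsilon>) 4 (Th 3)" and \<epsilon>: "\<epsilon> > 0"
    and space: "\<And>\<Psi>. csp_instance 4 n \<Psi> \<Longrightarrow> poly_size 2 n \<Psi> \<Longrightarrow> space_at_most A n \<Psi> b"
    and n: "n \<ge> 6" "5 * k + 1 \<le> n^2" "k > 0" and r: "2 * (b + 1) \<le> n"
    and \<delta>: "0 < \<delta>" "\<delta> \<le> 1" "32 * real n \<le> \<delta>\<^sup>2 * real (5 * k)"
    and gap: "44/135 + \<delta> < (4/9 + \<epsilon>) * (11/15 - \<delta>)"
    and large: "44/135 * (real n^4 / card (tuples n)) \<le> 44/135 + \<delta>/2" "exp (- real n) \<le> 1/50"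
    and small: "real (4 * k) * (2^23 * (real (b + 1) / real n)\<^sup>2) \<le> 1/100"
  shows False
proof -
  define K where "K = alg_step A n"
  define \<theta> where "\<theta> = (4/9 + \<epsilon>) * (11/15 - \<delta>)"
  define h where "h s = measure_pmf.prob (alg_out A n s) {v. \<theta> \<le> v}" for s
  define R where "R i s \<longleftrightarrow> (\<exists>\<Psi>. length \<Psi> = i \<and> set \<Psi> \<subseteq> unit_constrs n \<and> s \<in> set_pmf (memory A n \<Psi>))" for i s
  define \<Sigma> where "\<Sigma> = {x :: bool list. length x \<le> b}"
  define U where "U = pmf_of_set (Pow {..<n})"
  define J0 where "J0 = bind_pmf U (\<lambda>X. map_pmf (Pair X) (alg_init A n))"
  define J1 where "J1 = observe_iter (planted n D_0) K k J0"
  define Q where "Q Y X = seq_pmf (replicate k (planted n D_0 X) @ replicate (4*k) (planted n Y X))" for Y X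
  define q where "q = expect J1 (\<lambda>z. noise_accept (unit_constrs n) K h (4*k) (snd z))"
  have n4: "n \<ge> 4" using n by simp
  have h01: "0 \<le> h s" "h s \<le> 1" for s by (auto simp: h_def)
  have R: "R (Suc i) t" if "R i s" "c \<in> unit_constrs n" "t \<in> set_pmf (K s c)" for i s c t
  proof -
    obtain \<Psi> where "length \<Psi> = i" "set \<Psi> \<subseteq> unit_constrs n" "s \<in> set_pmf (memory A n \<Psi>)"
      using \<open>R i s\<close> unfolding R_def by blast
    then have "length (\<Psi> @ [c]) = Suc i \<and> set (\<Psi> @ [c]) \<subseteq> unit_constrs n \<and> t \<in> set_pmf (memory A n (\<Psi> @ [c]))"
      using that by (auto simp: memory_append bind_return_pmf' K_def)
    then show ?thesis unfolding R_def by blast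
  qed
  have R\<Sigma>: "s \<in> \<Sigma>" if "R i s" "i \<le> 5 * k" for i s
  proof -
    obtain \<Psi> where \<Psi>: "length \<Psi> = i" "set \<Psi> \<subseteq> unit_constrs n" "s \<in> set_pmf (memory A n \<Psi>)"
      using \<open>R i s\<close> unfolding R_def by blast
    \<comment> \<open>A spare constraint is appended because \<open>\<Psi>\<close> may be empty and
      then is no instance, so the space bound would not apply. This accounts for the
      \<open>+ 1\<close> in \<open>5 * k + 1 \<le> n^2\<close>.\<close>
    obtain c where c: "c \<in> unit_constrs n" using unit_constrs_nonempty[OF n4] by blast
    have "set (\<Psi> @ [c]) \<subseteq> unit_constrs n" "length (\<Psi> @ [c]) \<le> n^2" using \<Psi> c that n by auto
    then have "space_at_most A n (\<Psi> @ [c]) b"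
      using n by (intro space unit_constrs_instance unit_constrs_poly_size) auto
    moreover have "i \<le> length (\<Psi> @ [c])" "take i (\<Psi> @ [c]) = \<Psi>" using \<Psi> by auto
    ultimately have "\<forall>x\<in>set_pmf (memory A n \<Psi>). length x \<le> b"
      unfolding space_at_most_def by metis
    then show ?thesis using \<Psi> by (simp add: \<Sigma>_def)
  qed
  have U: "set_pmf U = Pow {..<n}" unfolding U_def by (rule set_pmf_of_set) auto
  have J0: "set_pmf J0 \<subseteq> Pow {..<n} \<times> {s. R 0 s}" "map_pmf fst J0 = U"
  proof -
    show "set_pmf J0 \<subseteq> Pow {..<n} \<times> {s. R 0 s}"
      unfolding J0_def R_def using U by (auto simp: memory_def)
    show "map_pmf fst J0 = U"
      by (simp add: J0_def map_bind_pmf pmf.map_comp o_def map_pmf_const bind_return_pmf')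
  qed
  have P: "set_pmf (planted n Y X) \<subseteq> unit_constrs n" if "set_pmf Y \<subseteq> cube 4" for Y X
    using set_pmf_planted[OF n4 that] .
  have J1: "set_pmf J1 \<subseteq> Pow {..<n} \<times> {s. R k s}" "map_pmf fst J1 = pmf_of_set (Pow {..<n})"
    using set_observe_iter[OF P[OF prime_support(1)], where R = R and K = K and J = J0 and i = 0 and A = "Pow {..<n}"] R J0(1)
    by (auto simp: J1_def map_fst_observe_iter J0(2) U_def)
  have close: "\<bar>expect (observe_iter (planted n Y) K (4*k) J1) (\<lambda>z. h (snd z)) - q\<bar> \<le> 1/10"
    if Y: "set_pmf Y \<subseteq> cube 4" "\<And>i. i < 4 \<Longrightarrow> expect Y (\<lambda>y. real_of_int (y ! i)) = 0" for Y
  proof -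
    \<comment> \<open>The potential parameter is \<open>l = 1/20\<close>; by \<open>small\<close>
      the second term is at most \<open>5 * 1/100\<close>, which balances the first.\<close>
    have "\<bar>expect (observe_iter (planted n Y) K (4*k) J1) (\<lambda>z. h (snd z)) - q\<bar>
      \<le> 1/20 + real (4*k) * (2^23 * (real (b + 1) / real n)\<^sup>2) / (4 * (1/20))"
      unfolding q_def
      using card_bool_lists_le[of b] r
      by (intro observe_iter_close[OF n(1) Y, where \<Sigma> = \<Sigma> and R = R and i = k and N = "5 * k"] R R\<Sigma> J1 h01)
        (auto simp: \<Sigma>_def)
    also have "\<dots> \<le> 1/10" using small by simp
    finally show ?thesis .
  qed
  have accept: "expect (observe_iter (planted n Y) K (4*k) J1) (\<lambda>z. h (snd z))
      = expect U (\<lambda>X. expect (Q Y X) (\<lambda>\<Psi>. measure_pmf.prob (alg_output A n \<Psi>) {v. \<theta> \<le> v}))" for Y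
  proof -
    have "\<bar>h (snd z)\<bar> \<le> 1" for z :: "nat set \<times> bool list" using h01 by simp
    note eb = expect_bind[of "\<lambda>z :: nat set \<times> bool list. h (snd z)", OF this]
    have "observe_iter (planted n Y) K (4*k) J1
       = bind_pmf U (\<lambda>X. bind_pmf (Q Y X) (\<lambda>\<Psi>. map_pmf (Pair X) (memory A n \<Psi>)))"
      unfolding J1_def J0_def Q_def memory_def K_def by (rule observe_twice)
    then show ?thesis
      by (simp add: eb alg_output_def prob_bind_eq h_def[symmetric])
  qed
  have inst: "csp_instance 4 n \<Psi>" if "set_pmf Y \<subseteq> cube 4" "\<Psi> \<in> set_pmf (Q Y X)" for Y X \<Psi>
  proof -
    have "set_pmf p \<subseteq> unit_constrs n" if "p \<in> set (replicate k (planted n D_0 X) @ replicate (4*k) (planted n Y X))" for p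
      using that P[OF prime_support(1)] P[OF \<open>set_pmf Y \<subseteq> cube 4\<close>] by (auto split: if_splits)
    from set_seq_pmf[OF this that(2)[unfolded Q_def]]
    have "length \<Psi> = 5 * k" "set \<Psi> \<subseteq> unit_constrs n" by simp_all
    then show ?thesis using n by (intro unit_constrs_instance) auto
  qed
  have "2/3 - 1/50 \<le> expect (Q D_Y_prime X) (\<lambda>\<Psi>. measure_pmf.prob (alg_output A n \<Psi>) {v. \<theta> \<le> v})" for X
  proof -
    have "exp (- 2 * real n) \<le> exp (- real n)" by simp
    then have "measure_pmf.prob (Q D_Y_prime X) {\<Psi>. csp_val (Th 3) n \<Psi> < 11/15 - \<delta>} \<le> 1/50"
      using yes_value[OF n4 refl n(3) \<delta>, of X] large(2) unfolding Q_def by linarith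
    then show ?thesis
      unfolding \<theta>_def using inst[OF prime_support(2)] by (intro prob_accept_ge[OF approx \<epsilon>]) auto
  qed
  then have "2/3 - 1/50 \<le> expect (observe_iter (planted n D_Y_prime) K (4*k) J1) (\<lambda>z. h (snd z))"
    unfolding accept
    by (intro measure_pmf.integral_ge_const integrable_measure_pmf_finite) (auto simp: U)
  moreover have "expect (Q D_N_prime X) (\<lambda>\<Psi>. measure_pmf.prob (alg_output A n \<Psi>) {v. \<theta> \<le> v}) \<le> 1/3 + 1/50" for X
  proof -
    have "measure_pmf.prob (Q D_N_prime X) {\<Psi>. 44/135 + \<delta> < csp_val (Th 3) n \<Psi>} \<le> 1/50"
      using no_value[OF n4 refl n(3) \<delta> large(1), of X] large(2) unfolding Q_def by linarith
    then show ?thesis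
      using inst[OF prime_support(3)] gap by (intro prob_accept_le[OF approx]) (auto simp: \<theta>_def)
  qed
  then have "expect (observe_iter (planted n D_N_prime) K (4*k) J1) (\<lambda>z. h (snd z)) \<le> 1/3 + 1/50"
    unfolding accept
    by (intro measure_pmf.integral_le_const integrable_measure_pmf_finite) (auto simp: U)
  \<comment> \<open>The acceptance probabilities differ by at least \<open>1/3 - 1/25\<close>, yet
    both lie within \<open>1/10\<close> of the same \<open>q\<close>.\<close>
  ultimately show False
    using close[OF prime_support(2) prime_unbiased(1)] close[OF prime_support(3) prime_unbiased(2)] by linarith
qed

lemma no_streaming_approximation:
  assumes \<epsilon>: "\<epsilon> > 0" and A: "uses_little_o_space A 4 (\<lambda>n. sqrt (real n))"
  shows "\<not> approximates A (4/9 + \<epsilon>) 4 (Th 3)"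
proof
  assume approx: "approximates A (4/9 + \<epsilon>) 4 (Th 3)"
  \<comment> \<open>Degree 2 is taken because the streams have length \<open>5 * C * n\<close> with
    \<open>C\<close> depending on \<open>\<epsilon>\<close>, which is eventually below
    \<open>n^2\<close>.\<close>
  obtain s where s: "(\<lambda>n. real (s n)) \<in> o(\<lambda>n. sqrt (real n))"
    and space: "\<And>n \<Psi>. csp_instance 4 n \<Psi> \<Longrightarrow> poly_size 2 n \<Psi> \<Longrightarrow> space_at_most A n \<Psi> (s n)"
    using A unfolding uses_little_o_space_def by blast
  \<comment> \<open>The gap amounts to
    \<open>\<delta> * (13/9 + \<epsilon>) < 11 * \<epsilon> / 15\<close>; this choice makes the left
    side at most \<open>\<epsilon>/2\<close>.\<close>
  define \<delta> where "\<delta> = \<epsilon> / (4 * (1 + \<epsilon>))"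
  have \<delta>: "0 < \<delta>" "\<delta> \<le> 1" using \<epsilon> by (auto simp: \<delta>_def field_simps)
  have gap: "44/135 + \<delta> < (4/9 + \<epsilon>) * (11/15 - \<delta>)"
  proof -
    have "\<delta> * (13/9 + \<epsilon>) \<le> \<delta> * (2 * (1 + \<epsilon>))" using \<delta> \<epsilon> by (intro mult_left_mono) auto
    also have "\<dots> = \<epsilon> / 2" using \<epsilon> by (simp add: \<delta>_def field_simps)
    also have "\<dots> < 11 * \<epsilon> / 15" using \<epsilon> by simp
    finally show ?thesis by (simp add: algebra_simps)
  qed
  define C where "C = nat \<lceil>32 / (5 * \<delta>\<^sup>2)\<rceil> + 1"
  have C: "32 \<le> \<delta>\<^sup>2 * (5 * real C)" "C \<ge> 1"
  proof -
    have "32 / (5 * \<delta>\<^sup>2) \<le> real C" unfolding C_def by linarith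
    then show "32 \<le> \<delta>\<^sup>2 * (5 * real C)" using \<delta> by (simp add: field_simps)
  qed (simp add: C_def)
  \<comment> \<open>Both \<open>s n\<close> and the extra 1 are at most \<open>c * sqrt n\<close>
    eventually. The accumulated divergence is then at most
    \<open>2^25 * C * 4 * c^2 = 1/(2^7 * C)\<close>, below \<open>1/100\<close>.\<close>
  define c where "c = 1 / (2^17 * real C)"
  have c: "c > 0" "c \<le> 1/4" using C by (auto simp: c_def field_simps)
  have "\<forall>\<^sub>F n in sequentially. norm (real (s n)) \<le> c * norm (sqrt (real n))"
    using landau_o.smallD[OF s c(1)] .
  moreover have "\<forall>\<^sub>F n in sequentially. 1 \<le> c * sqrt (real n)" using c(1) by real_asymp
  moreover have "\<forall>\<^sub>F n in sequentially. 44/135 * (real n^4 / card (tuples n)) < 44/135 + \<delta>/2"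
  proof -
    have "(\<lambda>n. 44/135 * (real n^4 / card (tuples n))) \<longlonglongrightarrow> 44/135 * 1"
      by (intro tendsto_intros tuples_ratio_tendsto)
    then show ?thesis using \<delta> by (intro order_tendstoD) auto
  qed
  moreover have "\<forall>\<^sub>F n in sequentially. exp (- real n) \<le> 1/50" by real_asymp
  moreover have "\<forall>\<^sub>F n in sequentially. n \<ge> 6 + 5 * C" by (rule eventually_ge_at_top)
  ultimately have "\<forall>\<^sub>F n in sequentially. False"
  proof eventually_elim
    case (elim n)
    have r: "real (s n + 1) \<le> 2 * c * sqrt (real n)" using elim by simp
    have sq: "(real (s n + 1))\<^sup>2 \<le> 4 * c\<^sup>2 * real n"
    proof -
      have "(real (s n + 1))\<^sup>2 \<le> (2 * c * sqrt (real n))\<^sup>2" by (rule power_mono[OF r]) simp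
      also have "\<dots> = 4 * c\<^sup>2 * real n" by (simp add: power_mult_distrib)
      finally show ?thesis .
    qed
    have "2 * real (s n + 1) \<le> 4 * c * sqrt (real n)" using r by simp
    also have "\<dots> \<le> 1 * sqrt (real n)" using c by (intro mult_right_mono) auto
    also have "sqrt (real n) \<le> real n" using elim(5) by (intro real_le_lsqrt) (auto simp: power2_eq_square)
    finally have 2: "2 * (s n + 1) \<le> n" by simp
    have "6 * n + 5 * C * n = (6 + 5 * C) * n" by (simp add: algebra_simps)
    also have "\<dots> \<le> n * n" using elim(5) by (rule mult_right_mono) simp
    finally have n2: "5 * (C * n) + 1 \<le> n^2" using elim(5) by (simp add: power2_eq_square)
    have small: "real (4 * (C * n)) * (2^23 * (real (s n + 1) / real n)\<^sup>2) \<le> 1/100"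
    proof -
      have "real (4 * (C * n)) * (2^23 * (real (s n + 1) / real n)\<^sup>2) = 2^25 * real C * ((real (s n + 1))\<^sup>2 / real n)"
        using elim(5) by (simp add: power_divide power2_eq_square)
      also have "\<dots> \<le> 2^25 * real C * (4 * c\<^sup>2)"
        using sq elim(5) by (intro mult_left_mono) (auto simp: divide_le_eq)
      also have "\<dots> = 1 / (2^7 * real C)" using C by (simp add: c_def power_divide power_mult_distrib power2_eq_square)
      also have "\<dots> \<le> 1/100" using C by (simp add: field_simps)
      finally show ?thesis .
    qed
    have "32 * real n \<le> (\<delta>\<^sup>2 * (5 * real C)) * real n" using C by (intro mult_right_mono) auto
    then have d3: "32 * real n \<le> \<delta>\<^sup>2 * real (5 * (C * n))" by (simp add: mult_ac)
    show False
      using streaming_contradiction[OF approx \<epsilon> space, of n "C * n" \<delta>] elim n2 2 \<delta> d3 gap small C by simp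
  qed
  then show False by simp
qed

theorem mainTheorem9:
  shows "D_N_star \<in> Delta 4 \<and> masses 4 D_N_star = [0, 0, 4/5, 1/5, 0]
    \<and> D_Y_star \<in> Delta 4 \<and> masses 4 D_Y_star = [4/15, 0, 0, 11/15, 0]
    \<and> D_0 \<in> Delta 4 \<and> masses 4 D_0 = [0, 0, 0, 1, 0]
    \<and> D_N_prime \<in> Delta 4 \<and> masses 4 D_N_prime = [0, 0, 1, 0, 0]
    \<and> D_Y_prime \<in> Delta 4 \<and> masses 4 D_Y_prime = [1/3, 0, 0, 2/3, 0]
    \<and> padded_one_wise_via 4 (1/5) D_0 D_Y_prime D_N_prime D_Y_star D_N_star
    \<and> padded_one_wise_pair 4 D_Y_star D_N_star
    \<and> (\<forall>\<epsilon> > 0. \<not> (\<exists>A. uses_little_o_space A 4 (\<lambda>n. sqrt (real n))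
          \<and> approximates A (4/9 + \<epsilon>) 4 (Th 3)))"
proof -
  have "padded_one_wise_pair 4 D_Y_star D_N_star"
    using star_properties star_padded_one_wise unfolding padded_one_wise_pair_def by blast
  then show ?thesis
    using star_properties star_padded_one_wise no_streaming_approximation by blast
qed

end
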